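(* Let $(\mathfrak{g},[~,~]_\mathfrak{g},N)$ and $(\mathfrak{h},[~,~]_\mathfrak{h},S)$ be two Nijenhuis Lie algebras. Then there is a bijection $$\mathcal{E}xt_{nab}((\mathfrak{g},N);(\mathfrak{h},S))\;\cong\; H^2_{nab}((\mathfrak{g},N);(\mathfrak{h},S))$$ between the set of isomorphism classes of non-abelian extensions of $(\mathfrak{g},[~,~]_\mathfrak{g},N)$ by $(\mathfrak{h},[~,~]_\mathfrak{h},S)$ and the non-abelian cohomology group of $(\mathfrak{g},[~,~]_\mathfrak{g},N)$ with values in $(\mathfrak{h},[~,~]_\mathfrak{h},S)$.
   Context: All vector spaces are over a fixed field. A Nijenhuis operator on a Lie algebra $(\mathfrak{g},[~,~]_\mathfrak{g})$ is a linear map $N:\mathfrak{g}\to\mathfrak{g}$ with $[N(x),N(y)]_\mathfrak{g}=N([N(x),y]_\mathfrak{g}+[x,N(y)]_\mathfrak{g}-N[x,y]_\mathfrak{g})$ for all $x,y\in\mathfrak{g}$. A Nijenhuis Lie algebra $(\mathfrak{g},[~,~]_\mathfrak{g},N)$ is a Lie algebra with a Nijenhuis operator $N$. A homomorphism $(\mathfrak{g},[~,~]_\mathfrak{g},N)\to(\mathfrak{h},[~,~]_\mathfrak{h},S)$ of Nijenhuis Lie algebras is a Lie algebra homomorphism $\Phi$ with $S\circ\Phi=\Phi\circ N$; it is an isomorphism if $\Phi$ is bijective. Non-abelian 2-cocycles: a non-abelian 2-cocycle of $(\mathfrak{g},[~,~]_\mathfrak{g},N)$ with values in $(\mathfrak{h},[~,~]_\mathfrak{h},S)$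 is a triple $(\chi,\psi,F)$ of linear maps $\chi:\wedge^2\mathfrak{g}\to\mathfrak{h}$, $\psi:\mathfrak{g}\to\mathrm{Der}(\mathfrak{h})$ ($x\mapsto\psi_x$, where $\mathrm{Der}(\mathfrak h)$ denotes the Lie algebra derivations of $\mathfrak h$), $F:\mathfrak{g}\to\mathfrak{h}$ such that for all $x,y,z\in\mathfrak{g}$, $h\in\mathfrak{h}$: (1) $\psi_x\psi_y(h)-\psi_y\psi_x(h)-\psi_{[x,y]_\mathfrak{g}}(h)=[\chi(x,y),h]_\mathfrak{h}$; (2) $\psi_x\chi(y,z)+\psi_y\chi(z,x)+\psi_z\chi(x,y)-\chi([x,y]_\mathfrak{g},z)-\chi([y,z]_\mathfrak{g},x)-\chi([z,x]_\mathfrak{g},y)=0$; (3) $\psi_{N(x)}S(h)=S(\psi_{N(x)}h+\psi_xS(h)-S(\psi_xh))+S[F(x),h]_\mathfrak{h}-[F(x),S(h)]_\mathfrak{h}$; (4) $\chi(N(x),N(y))-S(\chi(N(x),y)+\chi(x,N(y))-S(\chi(x,y)))-F([N(x),y]_\mathfrak{g}+[x,N(y)]_\mathfrak{g}-N[x,y]_\mathfrak{g})+\psi_{N(x)}F(y)-\psi_{N(y)}F(x)-S(\psi_xF(y)-\psi_yF(x)-F[x,y]_\mathfrak{g})+[F(x),F(y)]_\mathfrak{h}=0$. Two non-abelian 2-cocycles $(\chi,\psi,F)$ and $(\chi',\psi',F')$ are equivalent if there is a linear map $\varphi:\mathfrak{g}\to\mathfrak{h}$ such that for all $x,y\in\mathfrak{g}$,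 $h\in\mathfrak{h}$: $\psi_xh-\psi'_xh=[\varphi(x),h]_\mathfrak{h}$; $\chi(x,y)-\chi'(x,y)=\psi'_x(\varphi(y))-\psi'_y(\varphi(x))-\varphi([x,y]_\mathfrak{g})+[\varphi(x),\varphi(y)]_\mathfrak{h}$; $F(x)-F'(x)=S(\varphi(x))-\varphi(N(x))$. The non-abelian cohomology group $H^2_{nab}((\mathfrak{g},N);(\mathfrak{h},S))$ is the set of equivalence classes. Extensions: a non-abelian extension of $(\mathfrak{g},[~,~]_\mathfrak{g},N)$ by $(\mathfrak{h},[~,~]_\mathfrak{h},S)$ is a short exact sequence of Nijenhuis Lie algebras $0\to(\mathfrak{h},[~,~]_\mathfrak{h},S)\xrightarrow{i}(\mathfrak{e},[~,~]_\mathfrak{e},U)\xrightarrow{p}(\mathfrak{g},[~,~]_\mathfrak{g},N)\to0$ ($i,p$ homomorphisms of Nijenhuis Lie algebras). Two such extensions $(\mathfrak{e},U;i,p)$ and $(\mathfrak{e}',U';i',p')$ are isomorphic if there is an isomorphism $\Phi:\mathfrak{e}\to\mathfrak{e}'$ of Nijenhuis Lie algebras with $\Phi\circ i=i'$ and $p'\circ\Phi=p$. $\mathcal{E}xt_{nab}((\mathfrak{g},N);(\mathfrak{h},S))$ is the set of isomorphism classes. *)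

theory Defs
  imports "HOL-Algebra.Module"
begin

text \<open>
  Vector spaces over a field \<open>K\<close> are modules over \<open>K\<close> in the sense of HOL-Algebra. All structures
  live on carriers; a map or a record field is unspecified off the carriers, and every notion
  below, in particular every equivalence relation, only inspects values on carriers.
\<close>

definition linear_maps ::
  "('k, 'c) ring_scheme \<Rightarrow> ('k, 'a, 'm) module_scheme \<Rightarrow> ('k, 'b, 'n) module_scheme \<Rightarrow> ('a \<Rightarrow> 'b) set"
  where "linear_maps K V W = {f. f \<in> carrier V \<rightarrow> carrier W \<and>
    (\<forall>x\<in>carrier V. \<forall>y\<in>carrier V. f (x \<oplus>\<^bsub>V\<^esub> y) = f x \<oplus>\<^bsub>W\<^esub> f y) \<and>
    (\<forall>a\<in>carrier K. \<forall>x\<in>carrier V. f (a \<odot>\<^bsub>V\<^esub> x) = a \<odot>\<^bsub>W\<^esub> f x)}"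

text \<open>
  Linear maps from the exterior square of \<open>V\<close> to \<open>W\<close>, given as alternating bilinear maps. The
  condition \<open>b x x = 0\<close>, rather than skew-symmetry, is the correct one in every characteristic.
\<close>
definition alternating_maps ::
  "('k, 'c) ring_scheme \<Rightarrow> ('k, 'a, 'm) module_scheme \<Rightarrow> ('k, 'b, 'n) module_scheme
    \<Rightarrow> ('a \<Rightarrow> 'a \<Rightarrow> 'b) set"
  where "alternating_maps K V W = {b.
    (\<forall>x\<in>carrier V. (\<lambda>y. b x y) \<in> linear_maps K V W) \<and>
    (\<forall>y\<in>carrier V. (\<lambda>x. b x y) \<in> linear_maps K V W) \<and>
    (\<forall>x\<in>carrier V. b x x = \<zero>\<^bsub>W\<^esub>)}"


text \<open>The fields \<open>mult\<close> and \<open>one\<close> inherited from the \<open>module\<close> record play no role.\<close>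

record ('k, 'a) lie = "('k, 'a) module" +
  lie_bracket :: "'a \<Rightarrow> 'a \<Rightarrow> 'a"  (\<open>\<lbrakk>_, _\<rbrakk>\<index>\<close>)

locale lie_algebra = field K + module K L
  for K :: "('k, 'c) ring_scheme" and L :: "('k, 'a, 'm) lie_scheme" +
  assumes bracket_alternating: "lie_bracket L \<in> alternating_maps K L L"
    and jacobi: "\<lbrakk>x \<in> carrier L; y \<in> carrier L; z \<in> carrier L\<rbrakk> \<Longrightarrow>
      \<lbrakk>\<lbrakk>x, y\<rbrakk>\<^bsub>L\<^esub>, z\<rbrakk>\<^bsub>L\<^esub> \<oplus>\<^bsub>L\<^esub> \<lbrakk>\<lbrakk>y, z\<rbrakk>\<^bsub>L\<^esub>, x\<rbrakk>\<^bsub>L\<^esub> \<oplus>\<^bsub>L\<^esub> \<lbrakk>\<lbrakk>z, x\<rbrakk>\<^bsub>L\<^esub>, y\<rbrakk>\<^bsub>L\<^esub> = \<zero>\<^bsub>L\<^esub>"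

definition lie_homs ::
  "('k, 'c) ring_scheme \<Rightarrow> ('k, 'a, 'm) lie_scheme \<Rightarrow> ('k, 'b, 'n) lie_scheme \<Rightarrow> ('a \<Rightarrow> 'b) set"
  where "lie_homs K L M = {f \<in> linear_maps K L M.
    \<forall>x\<in>carrier L. \<forall>y\<in>carrier L. f (\<lbrakk>x, y\<rbrakk>\<^bsub>L\<^esub>) = \<lbrakk>f x, f y\<rbrakk>\<^bsub>M\<^esub>}"

definition lie_derivations ::
  "('k, 'c) ring_scheme \<Rightarrow> ('k, 'a, 'm) lie_scheme \<Rightarrow> ('a \<Rightarrow> 'a) set"
  where "lie_derivations K L = {D \<in> linear_maps K L L.
    \<forall>x\<in>carrier L. \<forall>y\<in>carrier L. D (\<lbrakk>x, y\<rbrakk>\<^bsub>L\<^esub>) = \<lbrakk>D x, y\<rbrakk>\<^bsub>L\<^esub> \<oplus>\<^bsub>L\<^esub> \<lbrakk>x, D y\<rbrakk>\<^bsub>L\<^esub>}"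

locale nijenhuis_lie_algebra = lie_algebra K L
  for K :: "('k, 'c) ring_scheme" and L :: "('k, 'a, 'm) lie_scheme" and N :: "'a \<Rightarrow> 'a" +
  assumes operator_linear: "N \<in> linear_maps K L L"
    and nijenhuis: "\<lbrakk>x \<in> carrier L; y \<in> carrier L\<rbrakk> \<Longrightarrow>
      \<lbrakk>N x, N y\<rbrakk>\<^bsub>L\<^esub> = N (\<lbrakk>N x, y\<rbrakk>\<^bsub>L\<^esub> \<oplus>\<^bsub>L\<^esub> \<lbrakk>x, N y\<rbrakk>\<^bsub>L\<^esub> \<ominus>\<^bsub>L\<^esub> N (\<lbrakk>x, y\<rbrakk>\<^bsub>L\<^esub>))"

definition nijenhuis_homs ::
  "('k, 'c) ring_scheme \<Rightarrow> ('k, 'a, 'm) lie_scheme \<Rightarrow> ('a \<Rightarrow> 'a)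
    \<Rightarrow> ('k, 'b, 'n) lie_scheme \<Rightarrow> ('b \<Rightarrow> 'b) \<Rightarrow> ('a \<Rightarrow> 'b) set"
  where "nijenhuis_homs K L N M S = {f \<in> lie_homs K L M. \<forall>x\<in>carrier L. S (f x) = f (N x)}"

definition nijenhuis_isos ::
  "('k, 'c) ring_scheme \<Rightarrow> ('k, 'a, 'm) lie_scheme \<Rightarrow> ('a \<Rightarrow> 'a)
    \<Rightarrow> ('k, 'b, 'n) lie_scheme \<Rightarrow> ('b \<Rightarrow> 'b) \<Rightarrow> ('a \<Rightarrow> 'b) set"
  where "nijenhuis_isos K L N M S =
    {f \<in> nijenhuis_homs K L N M S. bij_betw f (carrier L) (carrier M)}"


type_synonym ('g, 'h) cochain = "('g \<Rightarrow> 'g \<Rightarrow> 'h) \<times> ('g \<Rightarrow> 'h \<Rightarrow> 'h) \<times> ('g \<Rightarrow> 'h)"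

text \<open>
  The second and third conditions say that \<open>\<psi>\<close> is a linear map into the space of derivations of
  \<open>H\<close>, whose vector space structure is pointwise.
\<close>
definition nab_cocycles ::
  "('k, 'c) ring_scheme \<Rightarrow> ('k, 'g, 'm) lie_scheme \<Rightarrow> ('g \<Rightarrow> 'g)
    \<Rightarrow> ('k, 'h, 'n) lie_scheme \<Rightarrow> ('h \<Rightarrow> 'h) \<Rightarrow> ('g, 'h) cochain set"
  where "nab_cocycles K G N H S = {(\<chi>, \<psi>, F).
    \<chi> \<in> alternating_maps K G H \<and>
    \<psi> \<in> carrier G \<rightarrow> lie_derivations K H \<and>
    (\<forall>h\<in>carrier H. (\<lambda>x. \<psi> x h) \<in> linear_maps K G H) \<and>
    F \<in> linear_maps K G H \<and>
    (\<forall>x\<in>carrier G. \<forall>y\<in>carrier G. \<forall>h\<in>carrier H.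
      \<psi> x (\<psi> y h) \<ominus>\<^bsub>H\<^esub> \<psi> y (\<psi> x h) \<ominus>\<^bsub>H\<^esub> \<psi> (\<lbrakk>x, y\<rbrakk>\<^bsub>G\<^esub>) h = \<lbrakk>\<chi> x y, h\<rbrakk>\<^bsub>H\<^esub>) \<and>
    (\<forall>x\<in>carrier G. \<forall>y\<in>carrier G. \<forall>z\<in>carrier G.
      \<psi> x (\<chi> y z) \<oplus>\<^bsub>H\<^esub> \<psi> y (\<chi> z x) \<oplus>\<^bsub>H\<^esub> \<psi> z (\<chi> x y)
        \<ominus>\<^bsub>H\<^esub> \<chi> (\<lbrakk>x, y\<rbrakk>\<^bsub>G\<^esub>) z \<ominus>\<^bsub>H\<^esub> \<chi> (\<lbrakk>y, z\<rbrakk>\<^bsub>G\<^esub>) x \<ominus>\<^bsub>H\<^esub> \<chi> (\<lbrakk>z, x\<rbrakk>\<^bsub>G\<^esub>) y = \<zero>\<^bsub>H\<^esub>) \<and>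
    (\<forall>x\<in>carrier G. \<forall>h\<in>carrier H.
      \<psi> (N x) (S h) = S (\<psi> (N x) h \<oplus>\<^bsub>H\<^esub> \<psi> x (S h) \<ominus>\<^bsub>H\<^esub> S (\<psi> x h))
        \<oplus>\<^bsub>H\<^esub> S (\<lbrakk>F x, h\<rbrakk>\<^bsub>H\<^esub>) \<ominus>\<^bsub>H\<^esub> \<lbrakk>F x, S h\<rbrakk>\<^bsub>H\<^esub>) \<and>
    (\<forall>x\<in>carrier G. \<forall>y\<in>carrier G.
      \<chi> (N x) (N y) \<ominus>\<^bsub>H\<^esub> S (\<chi> (N x) y \<oplus>\<^bsub>H\<^esub> \<chi> x (N y) \<ominus>\<^bsub>H\<^esub> S (\<chi> x y))
        \<ominus>\<^bsub>H\<^esub> F (\<lbrakk>N x, y\<rbrakk>\<^bsub>G\<^esub> \<oplus>\<^bsub>G\<^esub> \<lbrakk>x, N y\<rbrakk>\<^bsub>G\<^esub> \<ominus>\<^bsub>G\<^esub> N (\<lbrakk>x, y\<rbrakk>\<^bsub>G\<^esub>))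
        \<oplus>\<^bsub>H\<^esub> \<psi> (N x) (F y) \<ominus>\<^bsub>H\<^esub> \<psi> (N y) (F x)
        \<ominus>\<^bsub>H\<^esub> S (\<psi> x (F y) \<ominus>\<^bsub>H\<^esub> \<psi> y (F x) \<ominus>\<^bsub>H\<^esub> F (\<lbrakk>x, y\<rbrakk>\<^bsub>G\<^esub>))
        \<oplus>\<^bsub>H\<^esub> \<lbrakk>F x, F y\<rbrakk>\<^bsub>H\<^esub> = \<zero>\<^bsub>H\<^esub>)}"

definition nab_cocycle_equiv ::
  "('k, 'c) ring_scheme \<Rightarrow> ('k, 'g, 'm) lie_scheme \<Rightarrow> ('g \<Rightarrow> 'g)
    \<Rightarrow> ('k, 'h, 'n) lie_scheme \<Rightarrow> ('h \<Rightarrow> 'h) \<Rightarrow> ('g, 'h) cochain rel"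
  where "nab_cocycle_equiv K G N H S = {((\<chi>, \<psi>, F), (\<chi>', \<psi>', F')).
    (\<chi>, \<psi>, F) \<in> nab_cocycles K G N H S \<and> (\<chi>', \<psi>', F') \<in> nab_cocycles K G N H S \<and>
    (\<exists>\<phi> \<in> linear_maps K G H.
      (\<forall>x\<in>carrier G. \<forall>h\<in>carrier H. \<psi> x h \<ominus>\<^bsub>H\<^esub> \<psi>' x h = \<lbrakk>\<phi> x, h\<rbrakk>\<^bsub>H\<^esub>) \<and>
      (\<forall>x\<in>carrier G. \<forall>y\<in>carrier G. \<chi> x y \<ominus>\<^bsub>H\<^esub> \<chi>' x y =
        \<psi>' x (\<phi> y) \<ominus>\<^bsub>H\<^esub> \<psi>' y (\<phi> x) \<ominus>\<^bsub>H\<^esub> \<phi> (\<lbrakk>x, y\<rbrakk>\<^bsub>G\<^esub>) \<oplus>\<^bsub>H\<^esub> \<lbrakk>\<phi> x, \<phi> y\<rbrakk>\<^bsub>H\<^esub>) \<and>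
      (\<forall>x\<in>carrier G. F x \<ominus>\<^bsub>H\<^esub> F' x = S (\<phi> x) \<ominus>\<^bsub>H\<^esub> \<phi> (N x)))}"

definition H2_nab ::
  "('k, 'c) ring_scheme \<Rightarrow> ('k, 'g, 'm) lie_scheme \<Rightarrow> ('g \<Rightarrow> 'g)
    \<Rightarrow> ('k, 'h, 'n) lie_scheme \<Rightarrow> ('h \<Rightarrow> 'h) \<Rightarrow> ('g, 'h) cochain set set"
  where "H2_nab K G N H S = nab_cocycles K G N H S // nab_cocycle_equiv K G N H S"


text \<open>
  An extension \<open>(E, U, i, p)\<close>. Neither the carrier of \<open>E\<close> nor any of its operations is fixed in
  advance; only the type \<open>'e\<close> in which the carrier lies is.
\<close>
type_synonym ('k, 'e, 'g, 'h) extension =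
  "('k, 'e) lie \<times> ('e \<Rightarrow> 'e) \<times> ('h \<Rightarrow> 'e) \<times> ('e \<Rightarrow> 'g)"

definition nab_extensions ::
  "('k, 'c) ring_scheme \<Rightarrow> ('k, 'g, 'm) lie_scheme \<Rightarrow> ('g \<Rightarrow> 'g)
    \<Rightarrow> ('k, 'h, 'n) lie_scheme \<Rightarrow> ('h \<Rightarrow> 'h) \<Rightarrow> ('k, 'e, 'g, 'h) extension set"
  where "nab_extensions K G N H S = {(E, U, i, p).
    nijenhuis_lie_algebra K E U \<and>
    i \<in> nijenhuis_homs K H S E U \<and>
    p \<in> nijenhuis_homs K E U G N \<and>
    inj_on i (carrier H) \<and>
    i ` carrier H = {e \<in> carrier E. p e = \<zero>\<^bsub>G\<^esub>} \<and>
    p ` carrier E = carrier G}"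

definition nab_extension_iso ::
  "('k, 'c) ring_scheme \<Rightarrow> ('k, 'g, 'm) lie_scheme \<Rightarrow> ('g \<Rightarrow> 'g)
    \<Rightarrow> ('k, 'h, 'n) lie_scheme \<Rightarrow> ('h \<Rightarrow> 'h) \<Rightarrow> ('k, 'e, 'g, 'h) extension rel"
  where "nab_extension_iso K G N H S = {((E, U, i, p), (E', U', i', p')).
    (E, U, i, p) \<in> nab_extensions K G N H S \<and> (E', U', i', p') \<in> nab_extensions K G N H S \<and>
    (\<exists>\<Phi> \<in> nijenhuis_isos K E U E' U'.
      (\<forall>h\<in>carrier H. \<Phi> (i h) = i' h) \<and> (\<forall>e\<in>carrier E. p' (\<Phi> e) = p e))}"

text \<open>
  Isomorphism classes of extensions whose carrier lies in the type \<open>'e\<close>. An extension of \<open>G\<close> by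
  \<open>H\<close> has an underlying set equipotent to \<open>carrier G \<times> carrier H\<close>; hence, as soon as that set
  embeds into \<open>'e\<close> (for instance if \<open>'e\<close> is \<open>'g \<times> 'h\<close>), every extension in whatever type is
  isomorphic to one in \<open>'e\<close>, and no isomorphism class is missing.
\<close>
definition Ext_nab ::
  "('k, 'c) ring_scheme \<Rightarrow> ('k, 'g, 'm) lie_scheme \<Rightarrow> ('g \<Rightarrow> 'g)
    \<Rightarrow> ('k, 'h, 'n) lie_scheme \<Rightarrow> ('h \<Rightarrow> 'h) \<Rightarrow> ('k, 'e, 'g, 'h) extension set set"
  where "Ext_nab K G N H S = nab_extensions K G N H S // nab_extension_iso K G N H S"

end

theory Submission
  imports Defs
begin

text \<open>
  Split an extension \<open>0 \<rightarrow> H \<rightarrow> E \<rightarrow> G \<rightarrow> 0\<close> by a linear section \<open>s\<close> of \<open>p\<close>, which exists over a field.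
  The bracket and the operator of \<open>E\<close> are then determined by how far \<open>s\<close> is from a homomorphism:
  \<open>[s x, s y] = s [x, y] + i (\<chi> x y)\<close>, \<open>[s x, i h] = i (\<psi> x h)\<close> and \<open>U (s x) = s (N x) + i (F x)\<close>.
  The Jacobi and Nijenhuis identities of \<open>E\<close>, evaluated on values of \<open>s\<close> and \<open>i\<close>, say precisely that
  \<open>(\<chi>, \<psi>, F)\<close> is a cocycle (\<open>extension_section.cocycle\<close>). Conversely, for a cocycle the same formulas
  turn \<open>G \<times> H\<close> into an extension (\<open>cocycle_model.model_section\<close>).

  Changing \<open>s\<close> by \<open>i \<phi>\<close> changes the cocycle by the equivalence with witness \<open>\<phi>\<close>
  (\<open>change_of_section\<close>, \<open>equiv_of_two_sections\<close>), an isomorphism of extensions carries sections to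
  sections with the same cocycle (\<open>section_transport\<close>), and extensions having a cocycle in common are
  isomorphic (\<open>iso_of_same_data\<close>). Hence the relation "\<open>X\<close> has a section with cocycle \<open>c\<close>" is total on
  both sides and relates isomorphism of extensions to equivalence of cocycles
  (\<open>extension_iso_iff_cocycle_equiv\<close>), and such a relation induces a bijection of the quotients
  (\<open>quotient_bijection\<close>).
\<close>

section \<open>Abelian groups\<close>

context abelian_group
begin

lemma add_diff_right: "\<lbrakk>a \<in> carrier G; b \<in> carrier G; c \<in> carrier G\<rbrakk> \<Longrightarrow> a \<oplus> (b \<ominus> c) = (a \<oplus> b) \<ominus> c"
  by (simp add: minus_eq a_ac)

lemma add_diff_left: "\<lbrakk>a \<in> carrier G; b \<in> carrier G; c \<in> carrier G\<rbrakk> \<Longrightarrow> (a \<ominus> b) \<oplus> c = (a \<oplus> c) \<ominus> b"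
  by (simp add: minus_eq a_ac)

lemma diff_diff_left: "\<lbrakk>a \<in> carrier G; b \<in> carrier G; c \<in> carrier G\<rbrakk> \<Longrightarrow> (a \<ominus> b) \<ominus> c = a \<ominus> (b \<oplus> c)"
  by (simp add: minus_eq minus_add a_ac)

lemma diff_diff_right: "\<lbrakk>a \<in> carrier G; b \<in> carrier G; c \<in> carrier G\<rbrakk> \<Longrightarrow> a \<ominus> (b \<ominus> c) = (a \<oplus> c) \<ominus> b"
  by (simp add: minus_eq minus_add a_ac)

lemma neg_as_diff: "a \<in> carrier G \<Longrightarrow> \<ominus> a = \<zero> \<ominus> a"
  by (simp add: minus_eq)

lemma diff_eq_iff: "\<lbrakk>a \<in> carrier G; b \<in> carrier G; c \<in> carrier G\<rbrakk> \<Longrightarrow> a \<ominus> b = c \<longleftrightarrow> a = c \<oplus> b"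
  by (metis add.inv_solve_right minus_eq)

lemma eq_diff_iff: "\<lbrakk>a \<in> carrier G; b \<in> carrier G; c \<in> carrier G\<rbrakk> \<Longrightarrow> c = a \<ominus> b \<longleftrightarrow> c \<oplus> b = a"
  by (metis diff_eq_iff)

lemma diff_zero: "a \<in> carrier G \<Longrightarrow> a \<ominus> \<zero> = a"
  by (simp add: diff_eq_iff)

text \<open>Moving every subtracted term to the other side of the equation leaves two sums without signs,
  and rewriting modulo associativity and commutativity decides whether they agree. Plain rewriting
  with \<open>a_ac\<close> and inverses does not, since a term and its negative need not end up adjacent.\<close>
lemmas abel_simps = a_ac add_diff_right add_diff_left diff_diff_left diff_diff_right
  neg_as_diff diff_eq_iff eq_diff_iff

end

section \<open>Linear and alternating maps\<close>

lemma (in module) smult_r_diff: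
  "\<lbrakk>a \<in> carrier R; x \<in> carrier M; y \<in> carrier M\<rbrakk> \<Longrightarrow>
    a \<odot>\<^bsub>M\<^esub> (x \<ominus>\<^bsub>M\<^esub> y) = a \<odot>\<^bsub>M\<^esub> x \<ominus>\<^bsub>M\<^esub> a \<odot>\<^bsub>M\<^esub> y"
  by (simp add: M.minus_eq smult_r_distr smult_r_minus)

lemma linear_mapsI:
  assumes "\<And>x. x \<in> carrier V \<Longrightarrow> f x \<in> carrier W"
    and "\<And>x y. \<lbrakk>x \<in> carrier V; y \<in> carrier V\<rbrakk> \<Longrightarrow> f (x \<oplus>\<^bsub>V\<^esub> y) = f x \<oplus>\<^bsub>W\<^esub> f y"
    and "\<And>a x. \<lbrakk>a \<in> carrier K; x \<in> carrier V\<rbrakk> \<Longrightarrow> f (a \<odot>\<^bsub>V\<^esub> x) = a \<odot>\<^bsub>W\<^esub> f x"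
  shows "f \<in> linear_maps K V W"
  using assms by (auto simp: linear_maps_def)

lemma linear_mapsD:
  assumes "f \<in> linear_maps K V W"
  shows "x \<in> carrier V \<Longrightarrow> f x \<in> carrier W"
    and "\<lbrakk>x \<in> carrier V; y \<in> carrier V\<rbrakk> \<Longrightarrow> f (x \<oplus>\<^bsub>V\<^esub> y) = f x \<oplus>\<^bsub>W\<^esub> f y"
    and "\<lbrakk>a \<in> carrier K; x \<in> carrier V\<rbrakk> \<Longrightarrow> f (a \<odot>\<^bsub>V\<^esub> x) = a \<odot>\<^bsub>W\<^esub> f x"
  using assms by (auto simp: linear_maps_def)

lemma linear_maps_zero:
  assumes "abelian_group V" "abelian_group W" "f \<in> linear_maps K V W"
  shows "f \<zero>\<^bsub>V\<^esub> = \<zero>\<^bsub>W\<^esub>"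
proof -
  interpret V: abelian_group V by fact
  interpret W: abelian_group W by fact
  note f = linear_mapsD[OF assms(3)]
  have "f \<zero>\<^bsub>V\<^esub> \<oplus>\<^bsub>W\<^esub> f \<zero>\<^bsub>V\<^esub> = f \<zero>\<^bsub>V\<^esub>"
    using f(2)[of "\<zero>\<^bsub>V\<^esub>" "\<zero>\<^bsub>V\<^esub>"] by simp
  then show ?thesis
    using f(1)[OF V.zero_closed] by simp
qed

lemma linear_maps_minus:
  assumes "abelian_group V" "abelian_group W" "f \<in> linear_maps K V W"
    and "x \<in> carrier V" "y \<in> carrier V"
  shows "f (x \<ominus>\<^bsub>V\<^esub> y) = f x \<ominus>\<^bsub>W\<^esub> f y"
proof -
  interpret V: abelian_group V by fact
  interpret W: abelian_group W by fact
  note f = linear_mapsD[OF assms(3)]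
  have "f (x \<ominus>\<^bsub>V\<^esub> y) \<oplus>\<^bsub>W\<^esub> f y = f (x \<ominus>\<^bsub>V\<^esub> y \<oplus>\<^bsub>V\<^esub> y)"
    using f(2)[of "x \<ominus>\<^bsub>V\<^esub> y" y] assms(4,5) by simp
  also have "x \<ominus>\<^bsub>V\<^esub> y \<oplus>\<^bsub>V\<^esub> y = x"
    using assms(4,5) by (simp add: V.abel_simps)
  finally show ?thesis
    using f(1) assms(4,5) by (simp add: W.eq_diff_iff)
qed

lemma linear_maps_neg:
  assumes "abelian_group V" "abelian_group W" "f \<in> linear_maps K V W" "x \<in> carrier V"
  shows "f (\<ominus>\<^bsub>V\<^esub> x) = \<ominus>\<^bsub>W\<^esub> f x"
proof -
  interpret V: abelian_group V by fact
  interpret W: abelian_group W by fact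
  show ?thesis
    using linear_maps_minus[OF assms(1-3) V.zero_closed assms(4)] linear_maps_zero[OF assms(1-3)]
      linear_mapsD(1)[OF assms(3,4)] assms(4)
    by (simp add: V.minus_eq W.minus_eq)
qed

lemma alternating_mapsD:
  assumes "b \<in> alternating_maps K V W"
  shows "x \<in> carrier V \<Longrightarrow> (\<lambda>y. b x y) \<in> linear_maps K V W"
    and "y \<in> carrier V \<Longrightarrow> (\<lambda>x. b x y) \<in> linear_maps K V W"
    and "x \<in> carrier V \<Longrightarrow> b x x = \<zero>\<^bsub>W\<^esub>"
  using assms by (auto simp: alternating_maps_def)

text \<open>Expand \<open>b (x + y) (x + y) = 0\<close>; the converse would fail in characteristic \<open>2\<close>.\<close>
lemma alternating_maps_skew:
  assumes "abelian_group V" "abelian_group W" "b \<in> alternating_maps K V W"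
    and xy: "x \<in> carrier V" "y \<in> carrier V"
  shows "b y x = \<ominus>\<^bsub>W\<^esub> b x y"
proof -
  interpret V: abelian_group V by fact
  interpret W: abelian_group W by fact
  note b = alternating_mapsD[OF assms(3)]
  note r = linear_mapsD[OF b(1)] and l = linear_mapsD[OF b(2)]
  have "b (x \<oplus>\<^bsub>V\<^esub> y) (x \<oplus>\<^bsub>V\<^esub> y) = b x (x \<oplus>\<^bsub>V\<^esub> y) \<oplus>\<^bsub>W\<^esub> b y (x \<oplus>\<^bsub>V\<^esub> y)"
    using xy by (intro l(2)) auto
  also have "\<dots> = b x y \<oplus>\<^bsub>W\<^esub> b y x"
    using xy by (simp add: r(1,2) b(3))
  finally have "b (x \<oplus>\<^bsub>V\<^esub> y) (x \<oplus>\<^bsub>V\<^esub> y) = b x y \<oplus>\<^bsub>W\<^esub> b y x" .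
  moreover have "b (x \<oplus>\<^bsub>V\<^esub> y) (x \<oplus>\<^bsub>V\<^esub> y) = \<zero>\<^bsub>W\<^esub>"
    using xy by (intro b(3)) simp
  ultimately have "b y x \<oplus>\<^bsub>W\<^esub> b x y = \<zero>\<^bsub>W\<^esub>"
    using xy by (simp add: r(1) W.a_comm)
  then show ?thesis
    using xy by (simp add: W.minus_equality r(1))
qed

section \<open>Linear sections\<close>

text \<open>The spaces may be infinite-dimensional, so Zorn's lemma provides the section: a maximal
  subspace \<open>M\<close> meeting the kernel of \<open>p\<close> trivially maps onto \<open>G\<close>, for otherwise it could be
  enlarged by a vector whose image lies outside \<open>p ` M\<close>. The section is the inverse of \<open>p\<close> on \<open>M\<close>.\<close>
lemma linear_section_exists:
  assumes "field K" and E: "module K E" and G: "module K G"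
    and p: "p \<in> linear_maps K E G" and surj: "p ` carrier E = carrier G"
  shows "\<exists>s \<in> linear_maps K G E. \<forall>x\<in>carrier G. p (s x) = x"
proof -
  interpret K: field K by fact
  interpret E: module K E by fact
  interpret G: module K G by fact
  note pD = linear_mapsD[OF p]
  note p0 = linear_maps_zero[OF E.M.abelian_group_axioms G.M.abelian_group_axioms p]
  note pm = linear_maps_minus[OF E.M.abelian_group_axioms G.M.abelian_group_axioms p]
  define A where "A = {W. submodule W K E \<and> (\<forall>w\<in>W. p w = \<zero>\<^bsub>G\<^esub> \<longrightarrow> w = \<zero>\<^bsub>E\<^esub>)}"
  have "submodule {\<zero>\<^bsub>E\<^esub>} K E"
    by (rule E.submoduleI) auto
  then have "A \<noteq> {}" by (auto simp: A_def)
  moreover have "\<Union>C \<in> A" if "C \<noteq> {}" "subset.chain A C" for C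
  proof -
    have CA: "W \<in> A" if "W \<in> C" for W
      using that \<open>subset.chain A C\<close> by (auto simp: subset.chain_def)
    then have sub: "submodule W K E" if "W \<in> C" for W
      using that by (auto simp: A_def)
    have chain: "V \<subseteq> W \<or> W \<subseteq> V" if "V \<in> C" "W \<in> C" for V W
      using that \<open>subset.chain A C\<close> unfolding subset_chain_def by blast
    note subE = E.submoduleE[OF sub]
    have "submodule (\<Union>C) K E"
    proof (rule E.submoduleI)
      show "\<Union>C \<subseteq> carrier E" using subE(1) by blast
      obtain W where W: "W \<in> C" using \<open>C \<noteq> {}\<close> by auto
      then obtain w where w: "w \<in> W" using subE(2) by blast
      have "w \<oplus>\<^bsub>E\<^esub> \<ominus>\<^bsub>E\<^esub> w = \<zero>\<^bsub>E\<^esub>" using subE(1)[OF W] w by (simp add: E.M.r_neg subsetD)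
      then show "\<zero>\<^bsub>E\<^esub> \<in> \<Union>C"
        using subE(5)[OF W w subE(3)[OF W w]] W by auto
    next
      fix a b assume "a \<in> \<Union>C" "b \<in> \<Union>C"
      then obtain V W where "V \<in> C" "a \<in> V" "W \<in> C" "b \<in> W" by auto
      then show "a \<oplus>\<^bsub>E\<^esub> b \<in> \<Union>C" using chain[of V W] subE(5) by blast
    qed (use subE(3,4) in blast)+
    then show ?thesis using CA by (fastforce simp: A_def)
  qed
  ultimately obtain M where M: "M \<in> A" and max: "\<And>X. X \<in> A \<Longrightarrow> M \<subseteq> X \<Longrightarrow> X = M"
    using subset_Zorn_nonempty[of A] by blast
  have Msub: "submodule M K E" and Mker: "\<And>w. \<lbrakk>w \<in> M; p w = \<zero>\<^bsub>G\<^esub>\<rbrakk> \<Longrightarrow> w = \<zero>\<^bsub>E\<^esub>"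
    using M by (auto simp: A_def)
  note ME = E.submoduleE[OF Msub]
  have Mc: "m \<in> carrier E" if "m \<in> M" for m using ME(1) that by auto
  have Mm: "m \<ominus>\<^bsub>E\<^esub> m' \<in> M" if "m \<in> M" "m' \<in> M" for m m'
    using that ME(3,5) by (simp add: E.M.minus_eq)
  obtain m\<^sub>0 where "m\<^sub>0 \<in> M" using ME(2) by auto
  then have M0: "\<zero>\<^bsub>E\<^esub> \<in> M" using Mm[of m\<^sub>0 m\<^sub>0] Mc by (simp add: E.M.minus_eq E.M.r_neg)
  have "p e \<in> p ` M" if e: "e \<in> carrier E" for e
  proof (rule ccontr)
    assume no: "p e \<notin> p ` M"
    define W where "W = {m \<oplus>\<^bsub>E\<^esub> a \<odot>\<^bsub>E\<^esub> e | m a. m \<in> M \<and> a \<in> carrier K}"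
    have WI: "m \<oplus>\<^bsub>E\<^esub> a \<odot>\<^bsub>E\<^esub> e \<in> W" if "m \<in> M" "a \<in> carrier K" for m a
      using that by (auto simp: W_def)
    have "submodule W K E"
    proof (rule E.submoduleI)
      show "W \<subseteq> carrier E" using e Mc by (auto simp: W_def)
      show "\<zero>\<^bsub>E\<^esub> \<in> W" using WI[OF M0 K.zero_closed] e by simp
      show "\<ominus>\<^bsub>E\<^esub> w \<in> W" if wW: "w \<in> W" for w
      proof -
        obtain m a where w: "m \<in> M" "a \<in> carrier K" "w = m \<oplus>\<^bsub>E\<^esub> a \<odot>\<^bsub>E\<^esub> e"
          using wW by (auto simp: W_def)
        have "\<ominus>\<^bsub>E\<^esub> w = (\<ominus>\<^bsub>E\<^esub> m) \<oplus>\<^bsub>E\<^esub> (\<ominus>\<^bsub>K\<^esub> a) \<odot>\<^bsub>E\<^esub> e"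
          using w e Mc by (simp add: E.smult_l_minus E.M.minus_add)
        then show ?thesis using WI w ME(3) by simp
      qed
      show "w \<oplus>\<^bsub>E\<^esub> w' \<in> W" if wW: "w \<in> W" "w' \<in> W" for w w'
      proof -
        obtain m a m' a' where w: "m \<in> M" "a \<in> carrier K" "w = m \<oplus>\<^bsub>E\<^esub> a \<odot>\<^bsub>E\<^esub> e"
          "m' \<in> M" "a' \<in> carrier K" "w' = m' \<oplus>\<^bsub>E\<^esub> a' \<odot>\<^bsub>E\<^esub> e"
          using wW by (auto simp: W_def)
        have "w \<oplus>\<^bsub>E\<^esub> w' = (m \<oplus>\<^bsub>E\<^esub> m') \<oplus>\<^bsub>E\<^esub> (a \<oplus>\<^bsub>K\<^esub> a') \<odot>\<^bsub>E\<^esub> e"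
          using w e Mc by (simp add: E.smult_l_distr E.M.a_ac)
        then show ?thesis using WI w ME(5) by simp
      qed
      show "b \<odot>\<^bsub>E\<^esub> w \<in> W" if b: "b \<in> carrier K" and wW: "w \<in> W" for b w
      proof -
        obtain m a where w: "m \<in> M" "a \<in> carrier K" "w = m \<oplus>\<^bsub>E\<^esub> a \<odot>\<^bsub>E\<^esub> e"
          using wW by (auto simp: W_def)
        have "b \<odot>\<^bsub>E\<^esub> w = (b \<odot>\<^bsub>E\<^esub> m) \<oplus>\<^bsub>E\<^esub> (b \<otimes>\<^bsub>K\<^esub> a) \<odot>\<^bsub>E\<^esub> e"
          using w e Mc b by (simp add: E.smult_r_distr E.smult_assoc1)
        then show ?thesis using WI w ME(4) b by simp
      qed
    qed
    moreover have "w = \<zero>\<^bsub>E\<^esub>" if wW: "w \<in> W" and pw0: "p w = \<zero>\<^bsub>G\<^esub>" for w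
    proof -
      obtain m a where w: "m \<in> M" "a \<in> carrier K" "w = m \<oplus>\<^bsub>E\<^esub> a \<odot>\<^bsub>E\<^esub> e"
        using wW by (auto simp: W_def)
      have pw: "p m \<oplus>\<^bsub>G\<^esub> a \<odot>\<^bsub>G\<^esub> p e = \<zero>\<^bsub>G\<^esub>"
        using pw0 w e Mc by (simp add: pD)
      \<comment> \<open>A nonzero \<open>a\<close> could be divided out, placing \<open>p e\<close> in the image of \<open>M\<close>.\<close>
      have "a = \<zero>\<^bsub>K\<^esub>"
      proof (rule ccontr)
        assume "a \<noteq> \<zero>\<^bsub>K\<^esub>"
        then have a: "a \<in> Units K" using w by (simp add: K.field_Units)
        define b where "b = inv\<^bsub>K\<^esub> a"
        have b: "b \<in> carrier K" "b \<otimes>\<^bsub>K\<^esub> a = \<one>\<^bsub>K\<^esub>"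
          using a by (simp_all add: b_def)
        have "b \<odot>\<^bsub>G\<^esub> (p m \<oplus>\<^bsub>G\<^esub> a \<odot>\<^bsub>G\<^esub> p e) = p (b \<odot>\<^bsub>E\<^esub> m) \<oplus>\<^bsub>G\<^esub> p e"
          using w b e Mc pD(1) by (simp add: G.smult_r_distr pD(3) flip: G.smult_assoc1)
        then have "p e \<oplus>\<^bsub>G\<^esub> p (b \<odot>\<^bsub>E\<^esub> m) = \<zero>\<^bsub>G\<^esub>"
          using pw w b e Mc pD(1) by (simp add: G.M.a_comm)
        then have "p e = \<ominus>\<^bsub>G\<^esub> p (b \<odot>\<^bsub>E\<^esub> m)"
          using w b e Mc pD(1) by (simp add: G.M.minus_equality)
        also have "\<dots> = p (\<ominus>\<^bsub>E\<^esub> (b \<odot>\<^bsub>E\<^esub> m))"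
          using w b Mc linear_maps_neg[OF E.M.abelian_group_axioms G.M.abelian_group_axioms p] by simp
        finally show False using no w b ME(3,4) by blast
      qed
      then show ?thesis using w e Mc pw Mker pD(1) by simp
    qed
    ultimately have "W \<in> A" by (simp add: A_def)
    moreover have "M \<subseteq> W"
    proof
      fix m assume "m \<in> M"
      then show "m \<in> W" using WI[of m "\<zero>\<^bsub>K\<^esub>"] Mc e by simp
    qed
    ultimately have "W = M" by (rule max)
    then have "e \<in> M" using WI[OF M0 K.one_closed] e by simp
    then show False using no by blast
  qed
  then have "p ` carrier E \<subseteq> p ` M" by (rule image_subsetI)
  then have onto: "p ` M = carrier G" using surj image_mono[OF ME(1), of p] by simp
  have inj: "m = m'" if "m \<in> M" "m' \<in> M" "p m = p m'" for m m'
  proof -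
    have "p (m \<ominus>\<^bsub>E\<^esub> m') = \<zero>\<^bsub>G\<^esub>"
      using that Mc pD(1) by (simp add: pm G.M.minus_eq G.M.r_neg)
    then have "m \<ominus>\<^bsub>E\<^esub> m' = \<zero>\<^bsub>E\<^esub>" using Mker Mm that by blast
    then show ?thesis using that Mc by (simp add: E.M.diff_eq_iff)
  qed
  define s where "s = inv_into M p"
  have sM: "s x \<in> M" and ps: "p (s x) = x" if "x \<in> carrier G" for x
    using that onto unfolding s_def by (auto intro: inv_into_into f_inv_into_f)
  have "s \<in> linear_maps K G E"
  proof (rule linear_mapsI)
    show "s x \<in> carrier E" if "x \<in> carrier G" for x using sM[OF that] Mc by blast
    show "s (x \<oplus>\<^bsub>G\<^esub> y) = s x \<oplus>\<^bsub>E\<^esub> s y" if "x \<in> carrier G" "y \<in> carrier G" for x y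
      by (rule inj) (use that sM Mc ps ME(5) in \<open>simp_all add: pD\<close>)
    show "s (a \<odot>\<^bsub>G\<^esub> x) = a \<odot>\<^bsub>E\<^esub> s x" if "a \<in> carrier K" "x \<in> carrier G" for a x
      by (rule inj) (use that sM Mc ps ME(4) in \<open>simp_all add: pD\<close>)
  qed
  then show ?thesis using ps by blast
qed

section \<open>Quotients\<close>

text \<open>A relation \<open>R\<close> that is total on both sides and matches \<open>r\<close> with \<open>t\<close> induces a bijection of
  quotients. Transitivity and symmetry of \<open>t\<close> are inherited from \<open>r\<close> through \<open>R\<close>, so that only one
  of the two relations has to be shown to be an equivalence.\<close>
lemma quotient_bijection:
  assumes r: "equiv A r" and t: "t \<subseteq> B \<times> B"
    and R: "\<And>a b. R a b \<Longrightarrow> a \<in> A \<and> b \<in> B"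
    and left: "\<And>a. a \<in> A \<Longrightarrow> \<exists>b. R a b" and right: "\<And>b. b \<in> B \<Longrightarrow> \<exists>a. R a b"
    and iff: "\<And>a b a' b'. \<lbrakk>R a b; R a' b'\<rbrakk> \<Longrightarrow> (a, a') \<in> r \<longleftrightarrow> (b, b') \<in> t"
  shows "\<exists>f. bij_betw f (A // r) (B // t)"
proof -
  have tB: "b \<in> B" "b' \<in> B" if "(b, b') \<in> t" for b b'
    using t that by auto
  note r' = equivE[OF r]
  have t_equiv: "equiv B t"
  proof (rule equivI)
    show "refl_on B t"
    proof (rule refl_onI)
      fix b assume "b \<in> B"
      then obtain a where a: "R a b" using right by auto
      then have "(a, a) \<in> r" using R[OF a] r' by (meson refl_onD)
      then show "(b, b) \<in> t" using iff[OF a a] by simp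
    qed
    show "sym t"
    proof (rule symI)
      fix b b' assume b: "(b, b') \<in> t"
      obtain a where a: "R a b" using right[OF tB(1)[OF b]] by auto
      obtain a' where a': "R a' b'" using right[OF tB(2)[OF b]] by auto
      show "(b', b) \<in> t" using b iff[OF a a'] iff[OF a' a] r' by (meson symD)
    qed
    show "trans t"
    proof (rule transI)
      fix b b' b'' assume b: "(b, b') \<in> t" "(b', b'') \<in> t"
      obtain a where a: "R a b" using right[OF tB(1)[OF b(1)]] by auto
      obtain a' where a': "R a' b'" using right[OF tB(2)[OF b(1)]] by auto
      obtain a'' where a'': "R a'' b''" using right[OF tB(2)[OF b(2)]] by auto
      show "(b, b'') \<in> t" using b iff[OF a a'] iff[OF a' a''] iff[OF a a''] r' by (meson transD)
    qed
  qed (fact t)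
  define f where "f C = t `` {b. \<exists>a\<in>C. R a b}" for C
  have f: "f (r `` {a}) = t `` {b}" if ab: "R a b" for a b
  proof -
    have "{b'. \<exists>a'\<in>r `` {a}. R a' b'} = t `` {b}"
    proof (rule equalityI; rule subsetI)
      fix b' assume "b' \<in> {b'. \<exists>a'\<in>r `` {a}. R a' b'}"
      then obtain a' where "(a, a') \<in> r" and a': "R a' b'" by auto
      then show "b' \<in> t `` {b}" using iff[OF ab a'] by simp
    next
      fix b' assume "b' \<in> t `` {b}"
      then have b': "(b, b') \<in> t" by simp
      obtain a' where a': "R a' b'" using right[OF tB(2)[OF b']] by auto
      then show "b' \<in> {b'. \<exists>a'\<in>r `` {a}. R a' b'}" using iff[OF ab a'] b' by auto
    qed
    then have "f (r `` {a}) = t `` (t `` {b})" by (simp add: f_def)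
    also have "\<dots> = t `` {b}"
    proof
      show "t `` (t `` {b}) \<subseteq> t `` {b}"
        using t_equiv by (meson ImageE Image_singleton_iff equivE subsetI transD)
      show "t `` {b} \<subseteq> t `` (t `` {b})"
        using equiv_class_self[OF t_equiv] R[OF ab] by auto
    qed
    finally show ?thesis .
  qed
  have "bij_betw f (A // r) (B // t)"
  proof (rule bij_betwI')
    fix C D assume "C \<in> A // r" "D \<in> A // r"
    then obtain a a' where a: "C = r `` {a}" "a \<in> A" "D = r `` {a'}" "a' \<in> A"
      by (auto elim!: quotientE)
    obtain b b' where b: "R a b" "R a' b'" using left[OF a(2)] left[OF a(4)] by auto
    show "f C = f D \<longleftrightarrow> C = D"
      unfolding a(1,3) f[OF b(1)] f[OF b(2)]
      using R[OF b(1)] R[OF b(2)] iff[OF b]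
        eq_equiv_class_iff[OF r, of a a'] eq_equiv_class_iff[OF t_equiv, of b b'] by simp
  next
    fix C assume "C \<in> A // r"
    then obtain a where a: "C = r `` {a}" "a \<in> A" by (auto elim!: quotientE)
    obtain b where b: "R a b" using left[OF a(2)] by auto
    show "f C \<in> B // t"
      unfolding a(1) f[OF b] using R[OF b] by (simp add: quotientI)
  next
    fix D assume "D \<in> B // t"
    then obtain b where b: "D = t `` {b}" "b \<in> B" by (auto elim!: quotientE)
    obtain a where a: "R a b" using right[OF b(2)] by auto
    show "\<exists>C\<in>A // r. D = f C"
      unfolding b(1) f[OF a, symmetric] using R[OF a] by (auto intro: quotientI)
  qed
  then show ?thesis by blast
qed

section \<open>Calculating in Nijenhuis Lie algebras\<close>

context lie_algebra
begin

lemma bracket_linear_right: "x \<in> carrier L \<Longrightarrow> (\<lambda>y. \<lbrakk>x, y\<rbrakk>\<^bsub>L\<^esub>) \<in> linear_maps K L L"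
  and bracket_linear_left: "y \<in> carrier L \<Longrightarrow> (\<lambda>x. \<lbrakk>x, y\<rbrakk>\<^bsub>L\<^esub>) \<in> linear_maps K L L"
  and bracket_self: "x \<in> carrier L \<Longrightarrow> \<lbrakk>x, x\<rbrakk>\<^bsub>L\<^esub> = \<zero>\<^bsub>L\<^esub>"
  using alternating_mapsD[OF bracket_alternating] by auto

lemmas bracket_closed [simp, intro] = linear_mapsD(1)[OF bracket_linear_right]
lemmas bracket_smult_right = linear_mapsD(3)[OF bracket_linear_right]
lemmas bracket_smult_left = linear_mapsD(3)[OF bracket_linear_left]

lemmas bracket_simps =
  linear_mapsD(2)[OF bracket_linear_right] linear_mapsD(2)[OF bracket_linear_left]
  linear_maps_minus[OF abelian_group_axioms abelian_group_axioms bracket_linear_right]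
  linear_maps_minus[OF abelian_group_axioms abelian_group_axioms bracket_linear_left]
  linear_maps_zero[OF abelian_group_axioms abelian_group_axioms bracket_linear_right]
  linear_maps_zero[OF abelian_group_axioms abelian_group_axioms bracket_linear_left]

lemma bracket_skew: "\<lbrakk>x \<in> carrier L; y \<in> carrier L\<rbrakk> \<Longrightarrow> \<lbrakk>y, x\<rbrakk>\<^bsub>L\<^esub> = \<ominus>\<^bsub>L\<^esub> \<lbrakk>x, y\<rbrakk>\<^bsub>L\<^esub>"
  by (rule alternating_maps_skew[OF abelian_group_axioms abelian_group_axioms bracket_alternating])

end

context nijenhuis_lie_algebra
begin

lemmas operator_closed [simp, intro] = linear_mapsD(1)[OF operator_linear]
lemmas operator_smult = linear_mapsD(3)[OF operator_linear]
lemmas operator_simps = linear_mapsD(2)[OF operator_linear]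
  linear_maps_minus[OF abelian_group_axioms abelian_group_axioms operator_linear]
  linear_maps_zero[OF abelian_group_axioms abelian_group_axioms operator_linear]

end

section \<open>Cocycles\<close>

locale nijenhuis_cocycle = G: nijenhuis_lie_algebra K G N + H: nijenhuis_lie_algebra K H S
  for K :: "('k, 'c) ring_scheme"
    and G :: "('k, 'g, 'm) lie_scheme" and N :: "'g \<Rightarrow> 'g"
    and H :: "('k, 'h, 'n) lie_scheme" and S :: "'h \<Rightarrow> 'h" +
  fixes \<chi> :: "'g \<Rightarrow> 'g \<Rightarrow> 'h" and \<psi> :: "'g \<Rightarrow> 'h \<Rightarrow> 'h" and F :: "'g \<Rightarrow> 'h"
  assumes cocycle: "(\<chi>, \<psi>, F) \<in> nab_cocycles K G N H S"
begin

lemma chi_alternating: "\<chi> \<in> alternating_maps K G H"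
  and psi_derivation: "x \<in> carrier G \<Longrightarrow> \<psi> x \<in> lie_derivations K H"
  and psi_linear_left: "h \<in> carrier H \<Longrightarrow> (\<lambda>x. \<psi> x h) \<in> linear_maps K G H"
  and F_linear: "F \<in> linear_maps K G H"
  using cocycle by (auto simp: nab_cocycles_def)

lemma psi_linear_right: "x \<in> carrier G \<Longrightarrow> \<psi> x \<in> linear_maps K H H"
  using psi_derivation by (auto simp: lie_derivations_def)

lemma psi_bracket: "\<lbrakk>x \<in> carrier G; h \<in> carrier H; k \<in> carrier H\<rbrakk> \<Longrightarrow>
    \<psi> x (\<lbrakk>h, k\<rbrakk>\<^bsub>H\<^esub>) = \<lbrakk>\<psi> x h, k\<rbrakk>\<^bsub>H\<^esub> \<oplus>\<^bsub>H\<^esub> \<lbrakk>h, \<psi> x k\<rbrakk>\<^bsub>H\<^esub>"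
  using psi_derivation by (auto simp: lie_derivations_def)

lemmas chi_linear_right = alternating_mapsD(1)[OF chi_alternating]
lemmas chi_linear_left = alternating_mapsD(2)[OF chi_alternating]

lemmas chi_closed [simp, intro] = linear_mapsD(1)[OF chi_linear_right]
lemmas psi_closed [simp, intro] = linear_mapsD(1)[OF psi_linear_right]
lemmas F_closed [simp, intro] = linear_mapsD(1)[OF F_linear]

lemmas cochain_smult = linear_mapsD(3)[OF chi_linear_right] linear_mapsD(3)[OF chi_linear_left]
  linear_mapsD(3)[OF psi_linear_right] linear_mapsD(3)[OF psi_linear_left]
  linear_mapsD(3)[OF F_linear]

lemmas cochain_simps =
  linear_mapsD(2)[OF chi_linear_right] linear_mapsD(2)[OF chi_linear_left]
  linear_mapsD(2)[OF psi_linear_right] linear_mapsD(2)[OF psi_linear_left]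
  linear_mapsD(2)[OF F_linear]
  linear_maps_minus[OF G.abelian_group_axioms H.abelian_group_axioms chi_linear_right]
  linear_maps_minus[OF G.abelian_group_axioms H.abelian_group_axioms chi_linear_left]
  linear_maps_minus[OF H.abelian_group_axioms H.abelian_group_axioms psi_linear_right]
  linear_maps_minus[OF G.abelian_group_axioms H.abelian_group_axioms psi_linear_left]
  linear_maps_minus[OF G.abelian_group_axioms H.abelian_group_axioms F_linear]
  linear_maps_zero[OF G.abelian_group_axioms H.abelian_group_axioms chi_linear_right]
  linear_maps_zero[OF G.abelian_group_axioms H.abelian_group_axioms chi_linear_left]
  linear_maps_zero[OF H.abelian_group_axioms H.abelian_group_axioms psi_linear_right]
  linear_maps_zero[OF G.abelian_group_axioms H.abelian_group_axioms psi_linear_left]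
  linear_maps_zero[OF G.abelian_group_axioms H.abelian_group_axioms F_linear]

lemma psi_commutator: "\<lbrakk>x \<in> carrier G; y \<in> carrier G; h \<in> carrier H\<rbrakk> \<Longrightarrow>
    \<psi> x (\<psi> y h) \<ominus>\<^bsub>H\<^esub> \<psi> y (\<psi> x h) \<ominus>\<^bsub>H\<^esub> \<psi> (\<lbrakk>x, y\<rbrakk>\<^bsub>G\<^esub>) h = \<lbrakk>\<chi> x y, h\<rbrakk>\<^bsub>H\<^esub>"
  and chi_cyclic: "\<lbrakk>x \<in> carrier G; y \<in> carrier G; z \<in> carrier G\<rbrakk> \<Longrightarrow>
    \<psi> x (\<chi> y z) \<oplus>\<^bsub>H\<^esub> \<psi> y (\<chi> z x) \<oplus>\<^bsub>H\<^esub> \<psi> z (\<chi> x y)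
      \<ominus>\<^bsub>H\<^esub> \<chi> (\<lbrakk>x, y\<rbrakk>\<^bsub>G\<^esub>) z \<ominus>\<^bsub>H\<^esub> \<chi> (\<lbrakk>y, z\<rbrakk>\<^bsub>G\<^esub>) x \<ominus>\<^bsub>H\<^esub> \<chi> (\<lbrakk>z, x\<rbrakk>\<^bsub>G\<^esub>) y = \<zero>\<^bsub>H\<^esub>"
  and psi_nijenhuis: "\<lbrakk>x \<in> carrier G; h \<in> carrier H\<rbrakk> \<Longrightarrow>
    \<psi> (N x) (S h) = S (\<psi> (N x) h \<oplus>\<^bsub>H\<^esub> \<psi> x (S h) \<ominus>\<^bsub>H\<^esub> S (\<psi> x h))
        \<oplus>\<^bsub>H\<^esub> S (\<lbrakk>F x, h\<rbrakk>\<^bsub>H\<^esub>) \<ominus>\<^bsub>H\<^esub> \<lbrakk>F x, S h\<rbrakk>\<^bsub>H\<^esub>"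
  and chi_nijenhuis: "\<lbrakk>x \<in> carrier G; y \<in> carrier G\<rbrakk> \<Longrightarrow>
    \<chi> (N x) (N y) \<ominus>\<^bsub>H\<^esub> S (\<chi> (N x) y \<oplus>\<^bsub>H\<^esub> \<chi> x (N y) \<ominus>\<^bsub>H\<^esub> S (\<chi> x y))
        \<ominus>\<^bsub>H\<^esub> F (\<lbrakk>N x, y\<rbrakk>\<^bsub>G\<^esub> \<oplus>\<^bsub>G\<^esub> \<lbrakk>x, N y\<rbrakk>\<^bsub>G\<^esub> \<ominus>\<^bsub>G\<^esub> N (\<lbrakk>x, y\<rbrakk>\<^bsub>G\<^esub>))
        \<oplus>\<^bsub>H\<^esub> \<psi> (N x) (F y) \<ominus>\<^bsub>H\<^esub> \<psi> (N y) (F x)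
        \<ominus>\<^bsub>H\<^esub> S (\<psi> x (F y) \<ominus>\<^bsub>H\<^esub> \<psi> y (F x) \<ominus>\<^bsub>H\<^esub> F (\<lbrakk>x, y\<rbrakk>\<^bsub>G\<^esub>))
        \<oplus>\<^bsub>H\<^esub> \<lbrakk>F x, F y\<rbrakk>\<^bsub>H\<^esub> = \<zero>\<^bsub>H\<^esub>"
  using cocycle unfolding nab_cocycles_def by blast+

end

section \<open>Extensions\<close>

locale nijenhuis_extension =
  G: nijenhuis_lie_algebra K G N + H: nijenhuis_lie_algebra K H S +
  E: nijenhuis_lie_algebra K E U
  for K :: "('k, 'c) ring_scheme"
    and G :: "('k, 'g, 'm) lie_scheme" and N :: "'g \<Rightarrow> 'g"
    and H :: "('k, 'h, 'n) lie_scheme" and S :: "'h \<Rightarrow> 'h"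
    and E :: "('k, 'e) lie" and U :: "'e \<Rightarrow> 'e" +
  fixes i :: "'h \<Rightarrow> 'e" and p :: "'e \<Rightarrow> 'g"
  assumes i_hom: "i \<in> nijenhuis_homs K H S E U" and p_hom: "p \<in> nijenhuis_homs K E U G N"
    and i_inj: "inj_on i (carrier H)"
    and exact: "i ` carrier H = {e \<in> carrier E. p e = \<zero>\<^bsub>G\<^esub>}"
    and p_surj: "p ` carrier E = carrier G"
begin

lemma i_linear: "i \<in> linear_maps K H E" and p_linear: "p \<in> linear_maps K E G"
  using i_hom p_hom by (auto simp: nijenhuis_homs_def lie_homs_def)

lemmas i_closed [simp, intro] = linear_mapsD(1)[OF i_linear]
lemmas p_closed [simp, intro] = linear_mapsD(1)[OF p_linear]

lemmas smult_simps = linear_mapsD(3)[OF i_linear] linear_mapsD(3)[OF p_linear]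
lemmas ip_linear_simps =
  linear_mapsD(2)[OF i_linear] linear_mapsD(2)[OF p_linear]
  linear_maps_minus[OF H.abelian_group_axioms E.abelian_group_axioms i_linear]
  linear_maps_minus[OF E.abelian_group_axioms G.abelian_group_axioms p_linear]
  linear_maps_zero[OF H.abelian_group_axioms E.abelian_group_axioms i_linear]
  linear_maps_zero[OF E.abelian_group_axioms G.abelian_group_axioms p_linear]

lemma i_bracket: "\<lbrakk>h \<in> carrier H; k \<in> carrier H\<rbrakk> \<Longrightarrow> \<lbrakk>i h, i k\<rbrakk>\<^bsub>E\<^esub> = i (\<lbrakk>h, k\<rbrakk>\<^bsub>H\<^esub>)"
  and p_bracket: "\<lbrakk>e \<in> carrier E; f \<in> carrier E\<rbrakk> \<Longrightarrow> p (\<lbrakk>e, f\<rbrakk>\<^bsub>E\<^esub>) = \<lbrakk>p e, p f\<rbrakk>\<^bsub>G\<^esub>"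
  and U_i: "h \<in> carrier H \<Longrightarrow> U (i h) = i (S h)"
  and p_U: "e \<in> carrier E \<Longrightarrow> p (U e) = N (p e)"
  using i_hom p_hom by (auto simp: nijenhuis_homs_def lie_homs_def)

lemma p_i: "h \<in> carrier H \<Longrightarrow> p (i h) = \<zero>\<^bsub>G\<^esub>"
  using exact by blast

lemma i_eq_iff: "\<lbrakk>h \<in> carrier H; k \<in> carrier H\<rbrakk> \<Longrightarrow> i h = i k \<longleftrightarrow> h = k"
  using i_inj by (auto dest: inj_onD)

text \<open>The inverse of \<open>i\<close> on its image, the kernel of \<open>p\<close>; unspecified elsewhere.\<close>
definition i_inv :: "'e \<Rightarrow> 'h" where "i_inv = inv_into (carrier H) i"

lemma i_inv:
  assumes "e \<in> carrier E" "p e = \<zero>\<^bsub>G\<^esub>"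
  shows "i_inv e \<in> carrier H" "i (i_inv e) = e"
proof -
  have "e \<in> i ` carrier H" using exact assms by blast
  then show "i_inv e \<in> carrier H" "i (i_inv e) = e"
    unfolding i_inv_def by (auto intro: inv_into_into f_inv_into_f)
qed

end

lemma nab_extensions_iff:
  assumes "nijenhuis_lie_algebra K G N" "nijenhuis_lie_algebra K H S"
  shows "(E, U, i, p) \<in> nab_extensions K G N H S \<longleftrightarrow> nijenhuis_extension K G N H S E U i p"
  using assms by (auto simp: nab_extensions_def nijenhuis_extension_def nijenhuis_extension_axioms_def)

text \<open>A linear section \<open>s\<close> of \<open>p\<close> need not be a homomorphism of Nijenhuis Lie algebras, and
  \<open>(\<chi>, \<psi>, F)\<close> measures this: \<open>\<chi>\<close> is the defect for the bracket, \<open>F\<close> the defect for the operator,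
  and \<open>\<psi>\<close> is the action of \<open>s x\<close> on the ideal \<open>H\<close>. Linearity of
  the cochain and the cocycle identities are consequences.\<close>
locale extension_section = nijenhuis_extension K G N H S E U i p
  for K :: "('k, 'c) ring_scheme"
    and G :: "('k, 'g, 'm) lie_scheme" and N :: "'g \<Rightarrow> 'g"
    and H :: "('k, 'h, 'n) lie_scheme" and S :: "'h \<Rightarrow> 'h"
    and E :: "('k, 'e) lie" and U :: "'e \<Rightarrow> 'e" and i :: "'h \<Rightarrow> 'e" and p :: "'e \<Rightarrow> 'g" +
  fixes s :: "'g \<Rightarrow> 'e"
    and \<chi> :: "'g \<Rightarrow> 'g \<Rightarrow> 'h" and \<psi> :: "'g \<Rightarrow> 'h \<Rightarrow> 'h" and F :: "'g \<Rightarrow> 'h"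
  assumes s_linear: "s \<in> linear_maps K G E" and p_s: "x \<in> carrier G \<Longrightarrow> p (s x) = x"
    and chi_closed: "\<lbrakk>x \<in> carrier G; y \<in> carrier G\<rbrakk> \<Longrightarrow> \<chi> x y \<in> carrier H"
    and psi_closed: "\<lbrakk>x \<in> carrier G; h \<in> carrier H\<rbrakk> \<Longrightarrow> \<psi> x h \<in> carrier H"
    and F_closed: "x \<in> carrier G \<Longrightarrow> F x \<in> carrier H"
    and s_bracket: "\<lbrakk>x \<in> carrier G; y \<in> carrier G\<rbrakk> \<Longrightarrow> \<lbrakk>s x, s y\<rbrakk>\<^bsub>E\<^esub> = s (\<lbrakk>x, y\<rbrakk>\<^bsub>G\<^esub>) \<oplus>\<^bsub>E\<^esub> i (\<chi> x y)"
    and s_i_bracket: "\<lbrakk>x \<in> carrier G; h \<in> carrier H\<rbrakk> \<Longrightarrow> \<lbrakk>s x, i h\<rbrakk>\<^bsub>E\<^esub> = i (\<psi> x h)"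
    and U_s: "x \<in> carrier G \<Longrightarrow> U (s x) = s (N x) \<oplus>\<^bsub>E\<^esub> i (F x)"
begin

lemmas s_closed [simp, intro] = linear_mapsD(1)[OF s_linear]
lemmas [simp, intro] = chi_closed psi_closed F_closed

lemmas s_smult = linear_mapsD(3)[OF s_linear]
lemmas linear_simps = ip_linear_simps linear_mapsD(2)[OF s_linear]
  linear_maps_minus[OF G.abelian_group_axioms E.abelian_group_axioms s_linear]
  linear_maps_zero[OF G.abelian_group_axioms E.abelian_group_axioms s_linear]

lemma i_s_bracket: "\<lbrakk>x \<in> carrier G; h \<in> carrier H\<rbrakk> \<Longrightarrow> \<lbrakk>i h, s x\<rbrakk>\<^bsub>E\<^esub> = \<zero>\<^bsub>E\<^esub> \<ominus>\<^bsub>E\<^esub> i (\<psi> x h)"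
  by (subst E.bracket_skew) (auto simp: s_i_bracket E.M.minus_eq)

text \<open>These rules bring every expression built from \<open>s\<close>, \<open>i\<close>, the bracket and \<open>U\<close> into a sum of
  terms of the forms \<open>s x\<close> and \<open>i h\<close>. The identities below compare such sums in \<open>E\<close>, and
  injectivity of \<open>i\<close> then brings them down to \<open>H\<close>.\<close>
lemmas expand = s_bracket s_i_bracket i_s_bracket i_bracket U_s U_i
  E.bracket_simps E.operator_simps linear_simps

lemma i_chi: "\<lbrakk>x \<in> carrier G; y \<in> carrier G\<rbrakk> \<Longrightarrow> i (\<chi> x y) = \<lbrakk>s x, s y\<rbrakk>\<^bsub>E\<^esub> \<ominus>\<^bsub>E\<^esub> s (\<lbrakk>x, y\<rbrakk>\<^bsub>G\<^esub>)"
  by (simp add: s_bracket E.M.abel_simps)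

lemma i_F: "x \<in> carrier G \<Longrightarrow> i (F x) = U (s x) \<ominus>\<^bsub>E\<^esub> s (N x)"
  by (simp add: U_s E.M.abel_simps)

lemma chi_alternating: "\<chi> \<in> alternating_maps K G H"
proof -
  have "(\<lambda>y. \<chi> x y) \<in> linear_maps K G H" if "x \<in> carrier G" for x
    by (rule linear_mapsI)
      (use that in \<open>simp_all add: i_chi linear_simps E.bracket_simps E.bracket_smult_right
        G.bracket_simps G.bracket_smult_right s_smult smult_simps E.M.abel_simps
        E.smult_r_distr E.smult_r_diff flip: i_eq_iff\<close>)
  moreover have "(\<lambda>x. \<chi> x y) \<in> linear_maps K G H" if "y \<in> carrier G" for y
    by (rule linear_mapsI)
      (use that in \<open>simp_all add: i_chi linear_simps E.bracket_simps E.bracket_smult_left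
        G.bracket_simps G.bracket_smult_left s_smult smult_simps E.M.abel_simps
        E.smult_r_distr E.smult_r_diff flip: i_eq_iff\<close>)
  moreover have "\<chi> x x = \<zero>\<^bsub>H\<^esub>" if "x \<in> carrier G" for x
    using that by (simp add: i_chi E.bracket_self G.bracket_self linear_simps E.M.abel_simps flip: i_eq_iff)
  ultimately show ?thesis by (simp add: alternating_maps_def)
qed

text \<open>The derivation rule is the Jacobi identity for \<open>s x\<close>, \<open>i h\<close> and \<open>i k\<close>.\<close>
lemma psi_derivation:
  assumes x: "x \<in> carrier G"
  shows "\<psi> x \<in> lie_derivations K H"
proof -
  have "\<psi> x \<in> linear_maps K H H"
    by (rule linear_mapsI)
      (use x in \<open>simp_all add: linear_simps E.bracket_simps E.bracket_smult_right smult_simps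
        flip: i_eq_iff s_i_bracket\<close>)
  moreover have "\<psi> x (\<lbrakk>h, k\<rbrakk>\<^bsub>H\<^esub>) = \<lbrakk>\<psi> x h, k\<rbrakk>\<^bsub>H\<^esub> \<oplus>\<^bsub>H\<^esub> \<lbrakk>h, \<psi> x k\<rbrakk>\<^bsub>H\<^esub>"
    if hk: "h \<in> carrier H" "k \<in> carrier H" for h k
  proof -
    have "\<lbrakk>\<lbrakk>s x, i h\<rbrakk>\<^bsub>E\<^esub>, i k\<rbrakk>\<^bsub>E\<^esub> \<oplus>\<^bsub>E\<^esub> \<lbrakk>\<lbrakk>i h, i k\<rbrakk>\<^bsub>E\<^esub>, s x\<rbrakk>\<^bsub>E\<^esub> \<oplus>\<^bsub>E\<^esub> \<lbrakk>\<lbrakk>i k, s x\<rbrakk>\<^bsub>E\<^esub>, i h\<rbrakk>\<^bsub>E\<^esub> = \<zero>\<^bsub>E\<^esub>"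
      using x hk by (intro E.jacobi) auto
    then show ?thesis
      using x hk by (simp add: expand H.bracket_skew[of h "\<psi> x k"] E.M.abel_simps
          H.M.neg_as_diff flip: i_eq_iff)
  qed
  ultimately show ?thesis by (simp add: lie_derivations_def)
qed

lemma psi_linear: "h \<in> carrier H \<Longrightarrow> (\<lambda>x. \<psi> x h) \<in> linear_maps K G H"
  by (rule linear_mapsI)
    (simp_all add: linear_simps E.bracket_simps E.bracket_smult_left smult_simps s_smult
        flip: i_eq_iff s_i_bracket)

lemma F_linear: "F \<in> linear_maps K G H"
  by (rule linear_mapsI)
    (simp_all add: i_F linear_simps E.operator_simps E.operator_smult G.operator_simps
      G.operator_smult smult_simps s_smult E.smult_r_diff E.M.abel_simps flip: i_eq_iff)

text \<open>The Jacobi identity for \<open>s x\<close>, \<open>s y\<close> and \<open>i h\<close>.\<close>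
lemma psi_commutator:
  assumes "x \<in> carrier G" "y \<in> carrier G" "h \<in> carrier H"
  shows "\<psi> x (\<psi> y h) \<ominus>\<^bsub>H\<^esub> \<psi> y (\<psi> x h) \<ominus>\<^bsub>H\<^esub> \<psi> (\<lbrakk>x, y\<rbrakk>\<^bsub>G\<^esub>) h = \<lbrakk>\<chi> x y, h\<rbrakk>\<^bsub>H\<^esub>"
proof -
  have "\<lbrakk>\<lbrakk>s x, s y\<rbrakk>\<^bsub>E\<^esub>, i h\<rbrakk>\<^bsub>E\<^esub> \<oplus>\<^bsub>E\<^esub> \<lbrakk>\<lbrakk>s y, i h\<rbrakk>\<^bsub>E\<^esub>, s x\<rbrakk>\<^bsub>E\<^esub> \<oplus>\<^bsub>E\<^esub> \<lbrakk>\<lbrakk>i h, s x\<rbrakk>\<^bsub>E\<^esub>, s y\<rbrakk>\<^bsub>E\<^esub> = \<zero>\<^bsub>E\<^esub>"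
    using assms by (intro E.jacobi) auto
  then show ?thesis
    using assms by (simp add: expand E.M.abel_simps flip: i_eq_iff)
qed

text \<open>The Jacobi identity for three values of \<open>s\<close>; its part in the image of \<open>s\<close> is the Jacobi
  identity of \<open>G\<close> and vanishes, and what remains is the claim.\<close>
lemma chi_cyclic:
  assumes "x \<in> carrier G" "y \<in> carrier G" "z \<in> carrier G"
  shows "\<psi> x (\<chi> y z) \<oplus>\<^bsub>H\<^esub> \<psi> y (\<chi> z x) \<oplus>\<^bsub>H\<^esub> \<psi> z (\<chi> x y)
      \<ominus>\<^bsub>H\<^esub> \<chi> (\<lbrakk>x, y\<rbrakk>\<^bsub>G\<^esub>) z \<ominus>\<^bsub>H\<^esub> \<chi> (\<lbrakk>y, z\<rbrakk>\<^bsub>G\<^esub>) x \<ominus>\<^bsub>H\<^esub> \<chi> (\<lbrakk>z, x\<rbrakk>\<^bsub>G\<^esub>) y = \<zero>\<^bsub>H\<^esub>"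
    (is "?lhs = _")
proof -
  have "i ?lhs \<oplus>\<^bsub>E\<^esub> (\<lbrakk>\<lbrakk>s x, s y\<rbrakk>\<^bsub>E\<^esub>, s z\<rbrakk>\<^bsub>E\<^esub> \<oplus>\<^bsub>E\<^esub> \<lbrakk>\<lbrakk>s y, s z\<rbrakk>\<^bsub>E\<^esub>, s x\<rbrakk>\<^bsub>E\<^esub> \<oplus>\<^bsub>E\<^esub> \<lbrakk>\<lbrakk>s z, s x\<rbrakk>\<^bsub>E\<^esub>, s y\<rbrakk>\<^bsub>E\<^esub>) =
    s (\<lbrakk>\<lbrakk>x, y\<rbrakk>\<^bsub>G\<^esub>, z\<rbrakk>\<^bsub>G\<^esub> \<oplus>\<^bsub>G\<^esub> \<lbrakk>\<lbrakk>y, z\<rbrakk>\<^bsub>G\<^esub>, x\<rbrakk>\<^bsub>G\<^esub> \<oplus>\<^bsub>G\<^esub> \<lbrakk>\<lbrakk>z, x\<rbrakk>\<^bsub>G\<^esub>, y\<rbrakk>\<^bsub>G\<^esub>)"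
    using assms by (simp add: expand E.M.abel_simps)
  then have "i ?lhs = i \<zero>\<^bsub>H\<^esub>"
    using assms by (simp only: G.jacobi E.jacobi s_closed) (simp add: linear_simps)
  then show ?thesis using assms by (simp add: i_eq_iff)
qed

text \<open>The Nijenhuis identity for \<open>s x\<close> and \<open>i h\<close>.\<close>
lemma psi_nijenhuis:
  assumes "x \<in> carrier G" "h \<in> carrier H"
  shows "\<psi> (N x) (S h) = S (\<psi> (N x) h \<oplus>\<^bsub>H\<^esub> \<psi> x (S h) \<ominus>\<^bsub>H\<^esub> S (\<psi> x h))
        \<oplus>\<^bsub>H\<^esub> S (\<lbrakk>F x, h\<rbrakk>\<^bsub>H\<^esub>) \<ominus>\<^bsub>H\<^esub> \<lbrakk>F x, S h\<rbrakk>\<^bsub>H\<^esub>"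
  using E.nijenhuis[of "s x" "i h"] assms
  by (simp add: expand H.operator_simps E.M.abel_simps flip: i_eq_iff)

text \<open>The Nijenhuis identity for \<open>s x\<close> and \<open>s y\<close>, minus the image under \<open>s\<close> of the one for \<open>x\<close> and \<open>y\<close> in \<open>G\<close>.\<close>
lemma chi_nijenhuis:
  assumes "x \<in> carrier G" "y \<in> carrier G"
  shows "\<chi> (N x) (N y) \<ominus>\<^bsub>H\<^esub> S (\<chi> (N x) y \<oplus>\<^bsub>H\<^esub> \<chi> x (N y) \<ominus>\<^bsub>H\<^esub> S (\<chi> x y))
        \<ominus>\<^bsub>H\<^esub> F (\<lbrakk>N x, y\<rbrakk>\<^bsub>G\<^esub> \<oplus>\<^bsub>G\<^esub> \<lbrakk>x, N y\<rbrakk>\<^bsub>G\<^esub> \<ominus>\<^bsub>G\<^esub> N (\<lbrakk>x, y\<rbrakk>\<^bsub>G\<^esub>))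
        \<oplus>\<^bsub>H\<^esub> \<psi> (N x) (F y) \<ominus>\<^bsub>H\<^esub> \<psi> (N y) (F x)
        \<ominus>\<^bsub>H\<^esub> S (\<psi> x (F y) \<ominus>\<^bsub>H\<^esub> \<psi> y (F x) \<ominus>\<^bsub>H\<^esub> F (\<lbrakk>x, y\<rbrakk>\<^bsub>G\<^esub>))
        \<oplus>\<^bsub>H\<^esub> \<lbrakk>F x, F y\<rbrakk>\<^bsub>H\<^esub> = \<zero>\<^bsub>H\<^esub>"
    (is "?lhs = _")
proof -
  let ?z = "\<lbrakk>N x, y\<rbrakk>\<^bsub>G\<^esub> \<oplus>\<^bsub>G\<^esub> \<lbrakk>x, N y\<rbrakk>\<^bsub>G\<^esub> \<ominus>\<^bsub>G\<^esub> N (\<lbrakk>x, y\<rbrakk>\<^bsub>G\<^esub>)"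
  note F_simps = linear_mapsD(2)[OF F_linear]
    linear_maps_minus[OF G.abelian_group_axioms H.abelian_group_axioms F_linear]
  let ?w = "\<lbrakk>U (s x), s y\<rbrakk>\<^bsub>E\<^esub> \<oplus>\<^bsub>E\<^esub> \<lbrakk>s x, U (s y)\<rbrakk>\<^bsub>E\<^esub> \<ominus>\<^bsub>E\<^esub> U (\<lbrakk>s x, s y\<rbrakk>\<^bsub>E\<^esub>)"
  have "i ?lhs \<oplus>\<^bsub>E\<^esub> (U ?w \<oplus>\<^bsub>E\<^esub> s (\<lbrakk>N x, N y\<rbrakk>\<^bsub>G\<^esub>)) = \<lbrakk>U (s x), U (s y)\<rbrakk>\<^bsub>E\<^esub> \<oplus>\<^bsub>E\<^esub> s (N ?z)"
    using assms
    by (simp add: expand F_simps H.operator_simps G.operator_simps E.M.abel_simps)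
  also have "\<dots> = U ?w \<oplus>\<^bsub>E\<^esub> s (\<lbrakk>N x, N y\<rbrakk>\<^bsub>G\<^esub>)"
    using assms by (simp add: G.nijenhuis E.nijenhuis)
  finally have "i ?lhs = i \<zero>\<^bsub>H\<^esub>"
    using assms by (simp add: linear_simps)
  then show ?thesis using assms by (simp add: i_eq_iff)
qed

lemma cocycle: "(\<chi>, \<psi>, F) \<in> nab_cocycles K G N H S"
  unfolding nab_cocycles_def
  using chi_alternating psi_derivation psi_linear F_linear psi_commutator chi_cyclic
    psi_nijenhuis chi_nijenhuis
  by simp

end

section \<open>The extension of a cocycle\<close>

text \<open>The extension of a cocycle lives on \<open>G \<times> H\<close>. The injection \<open>j\<close> carries this set into a type
  that need not be a product, so all operations are defined through the two components of a preimage
  under \<open>j\<close>.\<close>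
locale cocycle_model = nijenhuis_cocycle K G N H S \<chi> \<psi> F
  for K :: "('k, 'c) ring_scheme"
    and G :: "('k, 'g, 'm) lie_scheme" and N :: "'g \<Rightarrow> 'g"
    and H :: "('k, 'h, 'n) lie_scheme" and S :: "'h \<Rightarrow> 'h"
    and \<chi> :: "'g \<Rightarrow> 'g \<Rightarrow> 'h" and \<psi> :: "'g \<Rightarrow> 'h \<Rightarrow> 'h" and F :: "'g \<Rightarrow> 'h" +
  fixes j :: "'g \<times> 'h \<Rightarrow> 'e"
  assumes j_inj: "inj_on j (carrier G \<times> carrier H)"
begin

definition G_part :: "'e \<Rightarrow> 'g" where "G_part e = fst (inv_into (carrier G \<times> carrier H) j e)"
definition H_part :: "'e \<Rightarrow> 'h" where "H_part e = snd (inv_into (carrier G \<times> carrier H) j e)"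

text \<open>With \<open>(x, 0)\<close> in the role of \<open>s x\<close> and \<open>(0, h)\<close> in that of \<open>i h\<close>, the bracket and the
  operator below are forced once \<open>i\<close> is a homomorphism and \<open>s\<close> has the defects \<open>(\<chi>, \<psi>, F)\<close>.\<close>
definition model :: "('k, 'e) lie" where
  "model = \<lparr>carrier = j ` (carrier G \<times> carrier H), mult = undefined, one = undefined,
    zero = j (\<zero>\<^bsub>G\<^esub>, \<zero>\<^bsub>H\<^esub>),
    add = \<lambda>e f. j (G_part e \<oplus>\<^bsub>G\<^esub> G_part f, H_part e \<oplus>\<^bsub>H\<^esub> H_part f),
    smult = \<lambda>a e. j (a \<odot>\<^bsub>G\<^esub> G_part e, a \<odot>\<^bsub>H\<^esub> H_part e),
    lie_bracket = \<lambda>e f. j (\<lbrakk>G_part e, G_part f\<rbrakk>\<^bsub>G\<^esub>,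
      \<lbrakk>H_part e, H_part f\<rbrakk>\<^bsub>H\<^esub> \<oplus>\<^bsub>H\<^esub> \<psi> (G_part e) (H_part f) \<ominus>\<^bsub>H\<^esub> \<psi> (G_part f) (H_part e)
        \<oplus>\<^bsub>H\<^esub> \<chi> (G_part e) (G_part f))\<rparr>"

definition model_op :: "'e \<Rightarrow> 'e" where
  "model_op e = j (N (G_part e), F (G_part e) \<oplus>\<^bsub>H\<^esub> S (H_part e))"

lemma part_simps [simp]:
  assumes "x \<in> carrier G" "h \<in> carrier H"
  shows "G_part (j (x, h)) = x" "H_part (j (x, h)) = h"
  using assms inv_into_f_f[OF j_inj, of "(x, h)"] by (simp_all add: G_part_def H_part_def)

lemma j_eq_iff:
  "\<lbrakk>x \<in> carrier G; h \<in> carrier H; y \<in> carrier G; k \<in> carrier H\<rbrakk> \<Longrightarrow>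
    j (x, h) = j (y, k) \<longleftrightarrow> x = y \<and> h = k"
  using inj_on_eq_iff[OF j_inj, of "(x, h)" "(y, k)"] by simp

lemma model_carrier: "carrier model = j ` (carrier G \<times> carrier H)"
  by (simp add: model_def)

lemma j_in_model [simp, intro]:
  "\<lbrakk>x \<in> carrier G; h \<in> carrier H\<rbrakk> \<Longrightarrow> j (x, h) \<in> carrier model"
  by (simp add: model_carrier)

lemma in_modelE:
  assumes "e \<in> carrier model"
  obtains x h where "x \<in> carrier G" "h \<in> carrier H" "e = j (x, h)"
  using assms by (auto simp: model_carrier)

lemma model_ops:
  shows "\<zero>\<^bsub>model\<^esub> = j (\<zero>\<^bsub>G\<^esub>, \<zero>\<^bsub>H\<^esub>)"
    and "\<lbrakk>x \<in> carrier G; h \<in> carrier H; y \<in> carrier G; k \<in> carrier H\<rbrakk> \<Longrightarrow>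
      j (x, h) \<oplus>\<^bsub>model\<^esub> j (y, k) = j (x \<oplus>\<^bsub>G\<^esub> y, h \<oplus>\<^bsub>H\<^esub> k)"
    and "\<lbrakk>x \<in> carrier G; h \<in> carrier H\<rbrakk> \<Longrightarrow>
      a \<odot>\<^bsub>model\<^esub> j (x, h) = j (a \<odot>\<^bsub>G\<^esub> x, a \<odot>\<^bsub>H\<^esub> h)"
    and "\<lbrakk>x \<in> carrier G; h \<in> carrier H; y \<in> carrier G; k \<in> carrier H\<rbrakk> \<Longrightarrow>
      \<lbrakk>j (x, h), j (y, k)\<rbrakk>\<^bsub>model\<^esub> =
        j (\<lbrakk>x, y\<rbrakk>\<^bsub>G\<^esub>, \<lbrakk>h, k\<rbrakk>\<^bsub>H\<^esub> \<oplus>\<^bsub>H\<^esub> \<psi> x k \<ominus>\<^bsub>H\<^esub> \<psi> y h \<oplus>\<^bsub>H\<^esub> \<chi> x y)"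
    and "\<lbrakk>x \<in> carrier G; h \<in> carrier H\<rbrakk> \<Longrightarrow> model_op (j (x, h)) = j (N x, F x \<oplus>\<^bsub>H\<^esub> S h)"
  by (simp_all add: model_def model_op_def)

lemma model_module: "module K model"
proof (rule moduleI)
  show "cring K" by (rule G.cring_axioms)
  show "abelian_group model"
  proof (rule abelian_groupI)
    fix e assume "e \<in> carrier model"
    then obtain x h where e: "x \<in> carrier G" "h \<in> carrier H" "e = j (x, h)" by (rule in_modelE)
    then have "j (\<ominus>\<^bsub>G\<^esub> x, \<ominus>\<^bsub>H\<^esub> h) \<oplus>\<^bsub>model\<^esub> e = \<zero>\<^bsub>model\<^esub>"
      by (simp add: model_ops G.M.l_neg H.M.l_neg)
    then show "\<exists>f\<in>carrier model. f \<oplus>\<^bsub>model\<^esub> e = \<zero>\<^bsub>model\<^esub>"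
      using e by blast
  qed (auto elim!: in_modelE simp: model_ops G.M.a_ac H.M.a_ac)
qed (auto elim!: in_modelE simp: model_ops G.smult_l_distr G.smult_r_distr G.smult_assoc1
    H.smult_l_distr H.smult_r_distr H.smult_assoc1)

sublocale E: module K model
  by (rule model_module)

lemma model_minus:
  assumes "x \<in> carrier G" "h \<in> carrier H" "y \<in> carrier G" "k \<in> carrier H"
  shows "j (x, h) \<ominus>\<^bsub>model\<^esub> j (y, k) = j (x \<ominus>\<^bsub>G\<^esub> y, h \<ominus>\<^bsub>H\<^esub> k)"
  using assms by (subst E.M.diff_eq_iff) (auto simp: model_ops G.M.minus_eq H.M.minus_eq G.M.a_assoc H.M.a_assoc G.M.l_neg H.M.l_neg)

lemma model_bracket_alternating: "lie_bracket model \<in> alternating_maps K model model"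
proof -
  have "(\<lambda>f. \<lbrakk>e, f\<rbrakk>\<^bsub>model\<^esub>) \<in> linear_maps K model model" if "e \<in> carrier model" for e
    by (rule linear_mapsI; use that in \<open>elim in_modelE\<close>)
      (simp_all add: model_ops G.bracket_simps H.bracket_simps cochain_simps
        G.bracket_smult_right H.bracket_smult_right cochain_smult H.smult_r_distr H.smult_r_diff
        j_eq_iff H.M.abel_simps)
  moreover have "(\<lambda>e. \<lbrakk>e, f\<rbrakk>\<^bsub>model\<^esub>) \<in> linear_maps K model model" if "f \<in> carrier model" for f
    by (rule linear_mapsI; use that in \<open>elim in_modelE\<close>)
      (simp_all add: model_ops G.bracket_simps H.bracket_simps cochain_simps
        G.bracket_smult_left H.bracket_smult_left cochain_smult H.smult_r_distr H.smult_r_diff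
        j_eq_iff H.M.abel_simps)
  moreover have "\<lbrakk>e, e\<rbrakk>\<^bsub>model\<^esub> = \<zero>\<^bsub>model\<^esub>" if "e \<in> carrier model" for e
    using that alternating_mapsD(3)[OF chi_alternating]
    by (elim in_modelE) (simp add: model_ops G.bracket_self H.bracket_self H.M.minus_eq H.M.r_neg)
  ultimately show ?thesis by (simp add: alternating_maps_def)
qed

text \<open>The component in \<open>G\<close> is the Jacobi identity of \<open>G\<close>. After the derivation rule has removed
  \<open>\<psi> z [h, k]\<close>, the component in \<open>H\<close> combines, up to signs, the Jacobi identity of \<open>H\<close>, the cyclic condition on
  \<open>\<chi>\<close> and three instances of the commutator condition on \<open>\<psi>\<close>.\<close>
lemma model_jacobi:
  assumes "e \<in> carrier model" "f \<in> carrier model" "g \<in> carrier model"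
  shows "\<lbrakk>\<lbrakk>e, f\<rbrakk>\<^bsub>model\<^esub>, g\<rbrakk>\<^bsub>model\<^esub> \<oplus>\<^bsub>model\<^esub> \<lbrakk>\<lbrakk>f, g\<rbrakk>\<^bsub>model\<^esub>, e\<rbrakk>\<^bsub>model\<^esub> \<oplus>\<^bsub>model\<^esub> \<lbrakk>\<lbrakk>g, e\<rbrakk>\<^bsub>model\<^esub>, f\<rbrakk>\<^bsub>model\<^esub>
    = \<zero>\<^bsub>model\<^esub>"
proof -
  obtain x h where e: "x \<in> carrier G" "h \<in> carrier H" "e = j (x, h)" using assms(1) by (rule in_modelE)
  obtain y k where f: "y \<in> carrier G" "k \<in> carrier H" "f = j (y, k)" using assms(2) by (rule in_modelE)
  obtain z l where g: "z \<in> carrier G" "l \<in> carrier H" "g = j (z, l)" using assms(3) by (rule in_modelE)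
  define B where "B x h y k = \<lbrakk>h, k\<rbrakk>\<^bsub>H\<^esub> \<oplus>\<^bsub>H\<^esub> \<psi> x k \<ominus>\<^bsub>H\<^esub> \<psi> y h \<oplus>\<^bsub>H\<^esub> \<chi> x y" for x h y k
  have B: "B x h y k \<in> carrier H" "\<lbrakk>j (x, h), j (y, k)\<rbrakk>\<^bsub>model\<^esub> = j (\<lbrakk>x, y\<rbrakk>\<^bsub>G\<^esub>, B x h y k)"
    if "x \<in> carrier G" "h \<in> carrier H" "y \<in> carrier G" "k \<in> carrier H" for x h y k
    using that by (simp_all add: B_def model_ops)
  define J where "J = B (\<lbrakk>x, y\<rbrakk>\<^bsub>G\<^esub>) (B x h y k) z l \<oplus>\<^bsub>H\<^esub> B (\<lbrakk>y, z\<rbrakk>\<^bsub>G\<^esub>) (B y k z l) x h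
    \<oplus>\<^bsub>H\<^esub> B (\<lbrakk>z, x\<rbrakk>\<^bsub>G\<^esub>) (B z l x h) y k"
  have J: "J \<in> carrier H" using e f g by (simp add: J_def B_def)
  define P where "P x y l = \<psi> x (\<psi> y l) \<ominus>\<^bsub>H\<^esub> \<psi> y (\<psi> x l) \<ominus>\<^bsub>H\<^esub> \<psi> (\<lbrakk>x, y\<rbrakk>\<^bsub>G\<^esub>) l" for x y l
  \<comment> \<open>This identity holds by linearity, skew-symmetry and the derivation rule alone; the cocycle
    conditions then evaluate the added terms.\<close>
  have "J \<oplus>\<^bsub>H\<^esub> (\<psi> x (\<chi> y z) \<oplus>\<^bsub>H\<^esub> \<psi> y (\<chi> z x) \<oplus>\<^bsub>H\<^esub> \<psi> z (\<chi> x y)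
      \<ominus>\<^bsub>H\<^esub> \<chi> (\<lbrakk>x, y\<rbrakk>\<^bsub>G\<^esub>) z \<ominus>\<^bsub>H\<^esub> \<chi> (\<lbrakk>y, z\<rbrakk>\<^bsub>G\<^esub>) x \<ominus>\<^bsub>H\<^esub> \<chi> (\<lbrakk>z, x\<rbrakk>\<^bsub>G\<^esub>) y)
      \<oplus>\<^bsub>H\<^esub> (P x y l \<oplus>\<^bsub>H\<^esub> P y z h \<oplus>\<^bsub>H\<^esub> P z x k)
    = (\<lbrakk>\<lbrakk>h, k\<rbrakk>\<^bsub>H\<^esub>, l\<rbrakk>\<^bsub>H\<^esub> \<oplus>\<^bsub>H\<^esub> \<lbrakk>\<lbrakk>k, l\<rbrakk>\<^bsub>H\<^esub>, h\<rbrakk>\<^bsub>H\<^esub> \<oplus>\<^bsub>H\<^esub> \<lbrakk>\<lbrakk>l, h\<rbrakk>\<^bsub>H\<^esub>, k\<rbrakk>\<^bsub>H\<^esub>)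
      \<oplus>\<^bsub>H\<^esub> (\<lbrakk>\<chi> x y, l\<rbrakk>\<^bsub>H\<^esub> \<oplus>\<^bsub>H\<^esub> \<lbrakk>\<chi> y z, h\<rbrakk>\<^bsub>H\<^esub> \<oplus>\<^bsub>H\<^esub> \<lbrakk>\<chi> z x, k\<rbrakk>\<^bsub>H\<^esub>)"
    using e f g unfolding J_def B_def P_def
    by (simp add: H.bracket_simps cochain_simps psi_bracket H.bracket_skew[of h "\<psi> z k"]
        H.bracket_skew[of k "\<psi> x l"] H.bracket_skew[of l "\<psi> y h"] H.M.abel_simps)
  then have "J = \<zero>\<^bsub>H\<^esub>"
    using e f g J by (simp add: chi_cyclic H.jacobi P_def psi_commutator)
  then show ?thesis
    unfolding e(3) f(3) g(3) using e f g
    by (simp add: B model_ops(1,2) G.jacobi flip: J_def)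
qed

text \<open>The component in \<open>H\<close> combines, up to signs, the condition on \<open>\<chi> (N x) (N y)\<close>, the condition on
  \<open>\<psi> (N x) (S k)\<close>, its counterpart with the arguments exchanged, and the Nijenhuis identity of \<open>H\<close>.\<close>
lemma model_nijenhuis:
  assumes "e \<in> carrier model" "f \<in> carrier model"
  shows "\<lbrakk>model_op e, model_op f\<rbrakk>\<^bsub>model\<^esub> =
    model_op (\<lbrakk>model_op e, f\<rbrakk>\<^bsub>model\<^esub> \<oplus>\<^bsub>model\<^esub> \<lbrakk>e, model_op f\<rbrakk>\<^bsub>model\<^esub> \<ominus>\<^bsub>model\<^esub> model_op (\<lbrakk>e, f\<rbrakk>\<^bsub>model\<^esub>))"
proof -
  obtain x h where e: "x \<in> carrier G" "h \<in> carrier H" "e = j (x, h)" using assms(1) by (rule in_modelE)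
  obtain y k where f: "y \<in> carrier G" "k \<in> carrier H" "f = j (y, k)" using assms(2) by (rule in_modelE)
  define B where "B x h y k = \<lbrakk>h, k\<rbrakk>\<^bsub>H\<^esub> \<oplus>\<^bsub>H\<^esub> \<psi> x k \<ominus>\<^bsub>H\<^esub> \<psi> y h \<oplus>\<^bsub>H\<^esub> \<chi> x y" for x h y k
  have B: "B x h y k \<in> carrier H" "\<lbrakk>j (x, h), j (y, k)\<rbrakk>\<^bsub>model\<^esub> = j (\<lbrakk>x, y\<rbrakk>\<^bsub>G\<^esub>, B x h y k)"
    if "x \<in> carrier G" "h \<in> carrier H" "y \<in> carrier G" "k \<in> carrier H" for x h y k
    using that by (simp_all add: B_def model_ops)
  define z where "z = \<lbrakk>N x, y\<rbrakk>\<^bsub>G\<^esub> \<oplus>\<^bsub>G\<^esub> \<lbrakk>x, N y\<rbrakk>\<^bsub>G\<^esub> \<ominus>\<^bsub>G\<^esub> N (\<lbrakk>x, y\<rbrakk>\<^bsub>G\<^esub>)"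
  define L where "L = B (N x) (F x \<oplus>\<^bsub>H\<^esub> S h) (N y) (F y \<oplus>\<^bsub>H\<^esub> S k)"
  define M where "M = F z \<oplus>\<^bsub>H\<^esub> S (B (N x) (F x \<oplus>\<^bsub>H\<^esub> S h) y k \<oplus>\<^bsub>H\<^esub> B x h (N y) (F y \<oplus>\<^bsub>H\<^esub> S k)
    \<ominus>\<^bsub>H\<^esub> (F (\<lbrakk>x, y\<rbrakk>\<^bsub>G\<^esub>) \<oplus>\<^bsub>H\<^esub> S (B x h y k)))"
  define P where "P x h = S (\<psi> (N x) h \<oplus>\<^bsub>H\<^esub> \<psi> x (S h) \<ominus>\<^bsub>H\<^esub> S (\<psi> x h))
        \<oplus>\<^bsub>H\<^esub> S (\<lbrakk>F x, h\<rbrakk>\<^bsub>H\<^esub>) \<ominus>\<^bsub>H\<^esub> \<lbrakk>F x, S h\<rbrakk>\<^bsub>H\<^esub>" for x h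
  define Q where "Q = S (\<lbrakk>S h, k\<rbrakk>\<^bsub>H\<^esub> \<oplus>\<^bsub>H\<^esub> \<lbrakk>h, S k\<rbrakk>\<^bsub>H\<^esub> \<ominus>\<^bsub>H\<^esub> S (\<lbrakk>h, k\<rbrakk>\<^bsub>H\<^esub>))"
  have z: "z \<in> carrier G" using e f by (simp add: z_def)
  have LM: "L \<in> carrier H" "M \<in> carrier H" using e f by (simp_all add: L_def M_def B_def z_def)
  \<comment> \<open>By the cocycle conditions and the Nijenhuis identity of \<open>H\<close>, the block added on the left
    equals the last block on the right, and the middle block on the right vanishes.\<close>
  have "L \<oplus>\<^bsub>H\<^esub> (P x k \<oplus>\<^bsub>H\<^esub> \<psi> (N y) (S h) \<oplus>\<^bsub>H\<^esub> Q)
    = M \<oplus>\<^bsub>H\<^esub> (\<chi> (N x) (N y) \<ominus>\<^bsub>H\<^esub> S (\<chi> (N x) y \<oplus>\<^bsub>H\<^esub> \<chi> x (N y) \<ominus>\<^bsub>H\<^esub> S (\<chi> x y))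
        \<ominus>\<^bsub>H\<^esub> F (\<lbrakk>N x, y\<rbrakk>\<^bsub>G\<^esub> \<oplus>\<^bsub>G\<^esub> \<lbrakk>x, N y\<rbrakk>\<^bsub>G\<^esub> \<ominus>\<^bsub>G\<^esub> N (\<lbrakk>x, y\<rbrakk>\<^bsub>G\<^esub>))
        \<oplus>\<^bsub>H\<^esub> \<psi> (N x) (F y) \<ominus>\<^bsub>H\<^esub> \<psi> (N y) (F x)
        \<ominus>\<^bsub>H\<^esub> S (\<psi> x (F y) \<ominus>\<^bsub>H\<^esub> \<psi> y (F x) \<ominus>\<^bsub>H\<^esub> F (\<lbrakk>x, y\<rbrakk>\<^bsub>G\<^esub>))
        \<oplus>\<^bsub>H\<^esub> \<lbrakk>F x, F y\<rbrakk>\<^bsub>H\<^esub>)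
      \<oplus>\<^bsub>H\<^esub> (\<psi> (N x) (S k) \<oplus>\<^bsub>H\<^esub> P y h \<oplus>\<^bsub>H\<^esub> \<lbrakk>S h, S k\<rbrakk>\<^bsub>H\<^esub>)"
    using e f unfolding L_def M_def B_def P_def Q_def z_def
    by (simp add: H.bracket_simps H.operator_simps cochain_simps H.bracket_skew[of "F y" h]
        H.bracket_skew[of "F y" "S h"] H.M.abel_simps)
  also have "\<dots> = M \<oplus>\<^bsub>H\<^esub> (P x k \<oplus>\<^bsub>H\<^esub> \<psi> (N y) (S h) \<oplus>\<^bsub>H\<^esub> Q)"
    using e f LM unfolding P_def Q_def
    by (simp only: chi_nijenhuis H.nijenhuis psi_nijenhuis[symmetric] H.M.r_zero)
  finally have "L = M"
    using e f LM by (simp add: P_def Q_def)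
  then show ?thesis
    unfolding e(3) f(3) using e f
    by (simp add: B z model_ops(1,2,5) model_minus G.nijenhuis flip: z_def M_def L_def)
qed

lemma model_nijenhuis_lie_algebra: "nijenhuis_lie_algebra K model model_op"
proof -
  have "model_op \<in> linear_maps K model model"
    by (rule linear_mapsI; elim in_modelE)
      (simp_all add: model_ops G.operator_simps H.operator_simps cochain_simps G.operator_smult
        H.operator_smult cochain_smult H.smult_r_distr H.M.a_ac)
  then show ?thesis
    unfolding nijenhuis_lie_algebra_def nijenhuis_lie_algebra_axioms_def lie_algebra_def
      lie_algebra_axioms_def
    using G.field_axioms model_module model_bracket_alternating model_jacobi model_nijenhuis
    by blast
qed

lemma model_section:
  "extension_section K G N H S model model_op (\<lambda>h. j (\<zero>\<^bsub>G\<^esub>, h)) G_part (\<lambda>x. j (x, \<zero>\<^bsub>H\<^esub>)) \<chi> \<psi> F"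
proof -
  have "(\<lambda>h. j (\<zero>\<^bsub>G\<^esub>, h)) \<in> nijenhuis_homs K H S model model_op"
    by (auto simp: nijenhuis_homs_def lie_homs_def linear_maps_def model_ops G.bracket_self
      G.operator_simps cochain_simps alternating_mapsD(3)[OF chi_alternating] H.M.diff_zero)
  moreover have "G_part \<in> nijenhuis_homs K model model_op G N"
    by (auto simp: nijenhuis_homs_def lie_homs_def linear_maps_def model_ops elim!: in_modelE)
  moreover have "inj_on (\<lambda>h. j (\<zero>\<^bsub>G\<^esub>, h)) (carrier H)"
    by (auto simp: inj_on_def j_eq_iff)
  moreover have "(\<lambda>h. j (\<zero>\<^bsub>G\<^esub>, h)) ` carrier H = {e \<in> carrier model. G_part e = \<zero>\<^bsub>G\<^esub>}"
    by (auto elim!: in_modelE)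
  moreover have "G_part ` carrier model = carrier G"
    by (force simp: model_carrier)
  ultimately interpret X: nijenhuis_extension K G N H S model model_op "\<lambda>h. j (\<zero>\<^bsub>G\<^esub>, h)" G_part
    using model_nijenhuis_lie_algebra G.nijenhuis_lie_algebra_axioms H.nijenhuis_lie_algebra_axioms
    by (simp add: nijenhuis_extension_def nijenhuis_extension_axioms_def)
  show ?thesis
  proof
    show "(\<lambda>x. j (x, \<zero>\<^bsub>H\<^esub>)) \<in> linear_maps K G model"
      by (rule linear_mapsI) (simp_all add: model_ops)
  qed (simp_all add: model_ops G.bracket_simps H.bracket_simps H.operator_simps cochain_simps
      H.M.diff_zero)
qed

end

section \<open>Sections and isomorphisms\<close>

context extension_section
begin

text \<open>An element \<open>e\<close> is \<open>s x + i h\<close> for unique \<open>x\<close> and \<open>h\<close>, namely \<open>x = p e\<close> and this \<open>h\<close>.\<close>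
definition H_coord :: "'e \<Rightarrow> 'h" where "H_coord e = i_inv (e \<ominus>\<^bsub>E\<^esub> s (p e))"

lemma H_coord:
  assumes "e \<in> carrier E"
  shows "H_coord e \<in> carrier H" "s (p e) \<oplus>\<^bsub>E\<^esub> i (H_coord e) = e"
proof -
  have "p (e \<ominus>\<^bsub>E\<^esub> s (p e)) = \<zero>\<^bsub>G\<^esub>"
    using assms by (simp add: linear_simps p_s G.M.abel_simps)
  then have *: "H_coord e \<in> carrier H" "i (H_coord e) = e \<ominus>\<^bsub>E\<^esub> s (p e)"
    using i_inv[of "e \<ominus>\<^bsub>E\<^esub> s (p e)"] assms by (simp_all add: H_coord_def)
  then show "H_coord e \<in> carrier H" "s (p e) \<oplus>\<^bsub>E\<^esub> i (H_coord e) = e"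
    using assms by (simp_all add: E.M.minus_eq E.M.a_comm[of e] E.M.r_neg2)
qed

lemma coordE:
  assumes "e \<in> carrier E"
  obtains x h where "x \<in> carrier G" "h \<in> carrier H" "e = s x \<oplus>\<^bsub>E\<^esub> i h"
  using H_coord[OF assms] p_closed[OF assms] by metis

lemma p_coord: "\<lbrakk>x \<in> carrier G; h \<in> carrier H\<rbrakk> \<Longrightarrow> p (s x \<oplus>\<^bsub>E\<^esub> i h) = x"
  by (simp add: linear_simps p_s p_i)

lemma H_coord_coord:
  assumes "x \<in> carrier G" "h \<in> carrier H"
  shows "H_coord (s x \<oplus>\<^bsub>E\<^esub> i h) = h"
  using H_coord[of "s x \<oplus>\<^bsub>E\<^esub> i h"] assms by (simp add: p_coord i_eq_iff)

text \<open>In these coordinates the cochain determines all operations of the extension.\<close>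
lemma coord_ops:
  assumes "x \<in> carrier G" "h \<in> carrier H"
  shows "y \<in> carrier G \<Longrightarrow> k \<in> carrier H \<Longrightarrow>
      (s x \<oplus>\<^bsub>E\<^esub> i h) \<oplus>\<^bsub>E\<^esub> (s y \<oplus>\<^bsub>E\<^esub> i k) = s (x \<oplus>\<^bsub>G\<^esub> y) \<oplus>\<^bsub>E\<^esub> i (h \<oplus>\<^bsub>H\<^esub> k)"
    and "a \<in> carrier K \<Longrightarrow> a \<odot>\<^bsub>E\<^esub> (s x \<oplus>\<^bsub>E\<^esub> i h) = s (a \<odot>\<^bsub>G\<^esub> x) \<oplus>\<^bsub>E\<^esub> i (a \<odot>\<^bsub>H\<^esub> h)"
    and "y \<in> carrier G \<Longrightarrow> k \<in> carrier H \<Longrightarrow> \<lbrakk>s x \<oplus>\<^bsub>E\<^esub> i h, s y \<oplus>\<^bsub>E\<^esub> i k\<rbrakk>\<^bsub>E\<^esub> =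
      s (\<lbrakk>x, y\<rbrakk>\<^bsub>G\<^esub>) \<oplus>\<^bsub>E\<^esub> i (\<lbrakk>h, k\<rbrakk>\<^bsub>H\<^esub> \<oplus>\<^bsub>H\<^esub> \<psi> x k \<ominus>\<^bsub>H\<^esub> \<psi> y h \<oplus>\<^bsub>H\<^esub> \<chi> x y)"
    and "U (s x \<oplus>\<^bsub>E\<^esub> i h) = s (N x) \<oplus>\<^bsub>E\<^esub> i (F x \<oplus>\<^bsub>H\<^esub> S h)"
  using assms by (simp_all add: expand s_smult smult_simps E.smult_r_distr E.M.abel_simps)

end

text \<open>Two extensions with the same cochain have the same operations in coordinates, so
  \<open>s x + i h \<mapsto> s' x + i' h\<close> is an isomorphism.\<close>
lemma iso_of_same_data:
  assumes "extension_section K G N H S E U i p s \<chi> \<psi> F"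
    and "extension_section K G N H S E' U' i' p' s' \<chi> \<psi> F"
  shows "\<exists>\<Phi> \<in> nijenhuis_isos K E U E' U'.
      (\<forall>h\<in>carrier H. \<Phi> (i h) = i' h) \<and> (\<forall>e\<in>carrier E. p' (\<Phi> e) = p e)"
proof -
  interpret X: extension_section K G N H S E U i p s \<chi> \<psi> F by fact
  interpret Y: extension_section K G N H S E' U' i' p' s' \<chi> \<psi> F by fact
  define \<Phi> where "\<Phi> e = s' (p e) \<oplus>\<^bsub>E'\<^esub> i' (X.H_coord e)" for e
  define \<Phi>' where "\<Phi>' e = s (p' e) \<oplus>\<^bsub>E\<^esub> i (Y.H_coord e)" for e
  have \<Phi>: "\<Phi> (s x \<oplus>\<^bsub>E\<^esub> i h) = s' x \<oplus>\<^bsub>E'\<^esub> i' h" if "x \<in> carrier G" "h \<in> carrier H" for x h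
    using that by (simp add: \<Phi>_def X.p_coord X.H_coord_coord)
  have \<Phi>': "\<Phi>' (s' x \<oplus>\<^bsub>E'\<^esub> i' h) = s x \<oplus>\<^bsub>E\<^esub> i h" if "x \<in> carrier G" "h \<in> carrier H" for x h
    using that by (simp add: \<Phi>'_def Y.p_coord Y.H_coord_coord)
  have "\<Phi> \<in> linear_maps K E E'"
    by (rule linear_mapsI; elim X.coordE) (simp_all add: X.coord_ops Y.coord_ops \<Phi>)
  moreover have "\<Phi> (\<lbrakk>e, f\<rbrakk>\<^bsub>E\<^esub>) = \<lbrakk>\<Phi> e, \<Phi> f\<rbrakk>\<^bsub>E'\<^esub>" if "e \<in> carrier E" "f \<in> carrier E" for e f
    using that by (elim X.coordE) (simp add: X.coord_ops Y.coord_ops \<Phi>)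
  moreover have "U' (\<Phi> e) = \<Phi> (U e)" if "e \<in> carrier E" for e
    using that by (elim X.coordE) (simp add: X.coord_ops Y.coord_ops \<Phi>)
  moreover have "bij_betw \<Phi> (carrier E) (carrier E')"
    by (rule bij_betw_byWitness[of _ \<Phi>']) (auto elim!: X.coordE Y.coordE simp: \<Phi> \<Phi>')
  ultimately have "\<Phi> \<in> nijenhuis_isos K E U E' U'"
    by (simp add: nijenhuis_isos_def nijenhuis_homs_def lie_homs_def)
  moreover have "\<Phi> (i h) = i' h" if "h \<in> carrier H" for h
    using \<Phi>[OF X.G.M.zero_closed that] that by (simp add: X.linear_simps Y.linear_simps)
  moreover have "p' (\<Phi> e) = p e" if "e \<in> carrier E" for e
    using that by (elim X.coordE) (simp add: \<Phi> X.p_coord Y.p_coord)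
  ultimately show ?thesis by blast
qed

text \<open>The defects of a section are expressed by the operations, \<open>i\<close> and \<open>p\<close>, all of which an isomorphism
  of extensions preserves.\<close>
lemma section_transport:
  assumes "extension_section K G N H S E U i p s \<chi> \<psi> F"
    and "nijenhuis_extension K G N H S E' U' i' p'"
    and \<Phi>: "\<Phi> \<in> nijenhuis_isos K E U E' U'"
      "\<forall>h\<in>carrier H. \<Phi> (i h) = i' h" "\<forall>e\<in>carrier E. p' (\<Phi> e) = p e"
  shows "extension_section K G N H S E' U' i' p' (\<lambda>x. \<Phi> (s x)) \<chi> \<psi> F"
proof -
  interpret X: extension_section K G N H S E U i p s \<chi> \<psi> F by fact
  interpret Y: nijenhuis_extension K G N H S E' U' i' p' by fact
  have lin: "\<Phi> \<in> linear_maps K E E'"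
    and hom: "\<And>e f. \<lbrakk>e \<in> carrier E; f \<in> carrier E\<rbrakk> \<Longrightarrow> \<lbrakk>\<Phi> e, \<Phi> f\<rbrakk>\<^bsub>E'\<^esub> = \<Phi> (\<lbrakk>e, f\<rbrakk>\<^bsub>E\<^esub>)"
    and op: "\<And>e. e \<in> carrier E \<Longrightarrow> U' (\<Phi> e) = \<Phi> (U e)"
    using \<Phi>(1) by (auto simp: nijenhuis_isos_def nijenhuis_homs_def lie_homs_def)
  note D = linear_mapsD[OF lin]
  have i': "i' h = \<Phi> (i h)" if "h \<in> carrier H" for h
    using \<Phi>(2) that by simp
  show ?thesis
  proof
    show "(\<lambda>x. \<Phi> (s x)) \<in> linear_maps K G E'"
      by (rule linear_mapsI) (simp_all add: D X.linear_simps X.s_smult)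
  qed (use \<Phi>(3) in \<open>simp_all add: D hom op i' X.p_s X.s_bracket X.s_i_bracket X.U_s\<close>)
qed

text \<open>The equivalence relation on cocycles says exactly what adding \<open>i \<phi>\<close> to a section does to its
  defects. Here an equivalence moves a section, and in the next lemma two sections of one extension
  yield an equivalence.\<close>
lemma change_of_section:
  assumes "extension_section K G N H S E U i p s' \<chi>' \<psi>' F'"
    and "(\<chi>, \<psi>, F) \<in> nab_cocycles K G N H S" and \<phi>: "\<phi> \<in> linear_maps K G H"
    and eq: "\<forall>x\<in>carrier G. \<forall>h\<in>carrier H. \<psi> x h \<ominus>\<^bsub>H\<^esub> \<psi>' x h = \<lbrakk>\<phi> x, h\<rbrakk>\<^bsub>H\<^esub>"
      "\<forall>x\<in>carrier G. \<forall>y\<in>carrier G. \<chi> x y \<ominus>\<^bsub>H\<^esub> \<chi>' x y =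
        \<psi>' x (\<phi> y) \<ominus>\<^bsub>H\<^esub> \<psi>' y (\<phi> x) \<ominus>\<^bsub>H\<^esub> \<phi> (\<lbrakk>x, y\<rbrakk>\<^bsub>G\<^esub>) \<oplus>\<^bsub>H\<^esub> \<lbrakk>\<phi> x, \<phi> y\<rbrakk>\<^bsub>H\<^esub>"
      "\<forall>x\<in>carrier G. F x \<ominus>\<^bsub>H\<^esub> F' x = S (\<phi> x) \<ominus>\<^bsub>H\<^esub> \<phi> (N x)"
  shows "extension_section K G N H S E U i p (\<lambda>x. s' x \<oplus>\<^bsub>E\<^esub> i (\<phi> x)) \<chi> \<psi> F"
proof -
  interpret X: extension_section K G N H S E U i p s' \<chi>' \<psi>' F' by fact
  interpret C: nijenhuis_cocycle K G N H S \<chi> \<psi> F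
    by unfold_locales fact
  note D = linear_mapsD[OF \<phi>]
  show ?thesis
  proof
    show "(\<lambda>x. s' x \<oplus>\<^bsub>E\<^esub> i (\<phi> x)) \<in> linear_maps K G E"
      by (rule linear_mapsI)
        (simp_all add: D X.linear_simps X.s_smult X.smult_simps X.E.smult_r_distr X.E.M.a_ac)
    fix x assume x: "x \<in> carrier G"
    show "p (s' x \<oplus>\<^bsub>E\<^esub> i (\<phi> x)) = x" using x by (simp add: X.p_coord D)
    show "F x \<in> carrier H" using x by simp
    have "i (F x \<ominus>\<^bsub>H\<^esub> F' x) = i (S (\<phi> x) \<ominus>\<^bsub>H\<^esub> \<phi> (N x))"
      using eq(3) x by simp
    then have iF: "i (F x) = i (F' x) \<oplus>\<^bsub>E\<^esub> i (S (\<phi> x)) \<ominus>\<^bsub>E\<^esub> i (\<phi> (N x))"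
      using x by (simp add: D X.linear_simps X.E.M.abel_simps)
    show "U (s' x \<oplus>\<^bsub>E\<^esub> i (\<phi> x)) = s' (N x) \<oplus>\<^bsub>E\<^esub> i (\<phi> (N x)) \<oplus>\<^bsub>E\<^esub> i (F x)"
      using x by (simp add: iF D X.expand X.E.M.abel_simps)
    fix y assume y: "y \<in> carrier G"
    show "\<chi> x y \<in> carrier H" using x y by simp
    have "i (\<chi> x y \<ominus>\<^bsub>H\<^esub> \<chi>' x y) =
        i (\<psi>' x (\<phi> y) \<ominus>\<^bsub>H\<^esub> \<psi>' y (\<phi> x) \<ominus>\<^bsub>H\<^esub> \<phi> (\<lbrakk>x, y\<rbrakk>\<^bsub>G\<^esub>) \<oplus>\<^bsub>H\<^esub> \<lbrakk>\<phi> x, \<phi> y\<rbrakk>\<^bsub>H\<^esub>)"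
      using eq(2) x y by simp
    then have i\<chi>: "i (\<chi> x y) = i (\<chi>' x y) \<oplus>\<^bsub>E\<^esub> i (\<psi>' x (\<phi> y)) \<ominus>\<^bsub>E\<^esub> i (\<psi>' y (\<phi> x))
        \<ominus>\<^bsub>E\<^esub> i (\<phi> (\<lbrakk>x, y\<rbrakk>\<^bsub>G\<^esub>)) \<oplus>\<^bsub>E\<^esub> i (\<lbrakk>\<phi> x, \<phi> y\<rbrakk>\<^bsub>H\<^esub>)"
      using x y by (simp add: D X.linear_simps X.E.M.abel_simps)
    show "\<lbrakk>s' x \<oplus>\<^bsub>E\<^esub> i (\<phi> x), s' y \<oplus>\<^bsub>E\<^esub> i (\<phi> y)\<rbrakk>\<^bsub>E\<^esub> =
        s' (\<lbrakk>x, y\<rbrakk>\<^bsub>G\<^esub>) \<oplus>\<^bsub>E\<^esub> i (\<phi> (\<lbrakk>x, y\<rbrakk>\<^bsub>G\<^esub>)) \<oplus>\<^bsub>E\<^esub> i (\<chi> x y)"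
      using x y by (simp add: i\<chi> D X.expand X.E.M.abel_simps)
  next
    fix x h assume xh: "x \<in> carrier G" "h \<in> carrier H"
    then show "\<psi> x h \<in> carrier H" by simp
    have "i (\<psi> x h \<ominus>\<^bsub>H\<^esub> \<psi>' x h) = i (\<lbrakk>\<phi> x, h\<rbrakk>\<^bsub>H\<^esub>)" using eq(1) xh by simp
    then show "\<lbrakk>s' x \<oplus>\<^bsub>E\<^esub> i (\<phi> x), i h\<rbrakk>\<^bsub>E\<^esub> = i (\<psi> x h)"
      using xh by (simp add: D X.expand X.E.M.abel_simps)
  qed
qed

text \<open>Two sections of \<open>p\<close> differ by a map into its kernel, so \<open>s = s' + i \<phi>\<close> for a linear \<open>\<phi>\<close>.\<close>
lemma equiv_of_two_sections:
  assumes "extension_section K G N H S E U i p s \<chi> \<psi> F"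
    and "extension_section K G N H S E U i p s' \<chi>' \<psi>' F'"
  shows "((\<chi>, \<psi>, F), (\<chi>', \<psi>', F')) \<in> nab_cocycle_equiv K G N H S"
proof -
  interpret X: extension_section K G N H S E U i p s \<chi> \<psi> F by fact
  interpret Y: extension_section K G N H S E U i p s' \<chi>' \<psi>' F' by fact
  define \<phi> where "\<phi> x = Y.H_coord (s x)" for x
  have \<phi>_closed [simp]: "\<phi> x \<in> carrier H" and s: "s x = s' x \<oplus>\<^bsub>E\<^esub> i (\<phi> x)" if "x \<in> carrier G" for x
    using that Y.H_coord[of "s x"] X.p_s[of x] by (simp_all add: \<phi>_def)
  have i\<phi>: "i (\<phi> x) = s x \<ominus>\<^bsub>E\<^esub> s' x" if "x \<in> carrier G" for x
    using that by (simp add: s X.E.M.abel_simps)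
  have "\<phi> \<in> linear_maps K G H"
    by (rule linear_mapsI) (simp_all add: i\<phi> X.linear_simps Y.linear_simps X.s_smult Y.s_smult
        X.smult_simps X.E.smult_r_diff X.E.M.abel_simps flip: X.i_eq_iff)
  moreover have "\<psi> x h \<ominus>\<^bsub>H\<^esub> \<psi>' x h = \<lbrakk>\<phi> x, h\<rbrakk>\<^bsub>H\<^esub>" if "x \<in> carrier G" "h \<in> carrier H" for x h
    using X.s_i_bracket[OF that] that
    by (simp add: s Y.expand X.E.M.abel_simps flip: X.i_eq_iff)
  moreover have "\<chi> x y \<ominus>\<^bsub>H\<^esub> \<chi>' x y =
      \<psi>' x (\<phi> y) \<ominus>\<^bsub>H\<^esub> \<psi>' y (\<phi> x) \<ominus>\<^bsub>H\<^esub> \<phi> (\<lbrakk>x, y\<rbrakk>\<^bsub>G\<^esub>) \<oplus>\<^bsub>H\<^esub> \<lbrakk>\<phi> x, \<phi> y\<rbrakk>\<^bsub>H\<^esub>"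
    if "x \<in> carrier G" "y \<in> carrier G" for x y
    using that
    by (simp add: X.i_chi s Y.expand X.E.M.abel_simps flip: X.i_eq_iff)
  moreover have "F x \<ominus>\<^bsub>H\<^esub> F' x = S (\<phi> x) \<ominus>\<^bsub>H\<^esub> \<phi> (N x)" if "x \<in> carrier G" for x
    using that
    by (simp add: X.i_F s Y.expand X.E.M.abel_simps flip: X.i_eq_iff)
  ultimately show ?thesis
    unfolding nab_cocycle_equiv_def using X.cocycle Y.cocycle by blast
qed

section \<open>Classification\<close>

text \<open>An extension presents every cocycle obtained from one of its linear sections. Leaving the section
  free makes this a relation and not a function, so no choice of sections enters the classification.\<close>
definition presents where
  "presents K G N H S = (\<lambda>(E, U, i, p) (\<chi>, \<psi>, F). \<exists>s. extension_section K G N H S E U i p s \<chi> \<psi> F)"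

lemma (in nijenhuis_extension) section_data_exists:
  "\<exists>s \<chi> \<psi> F. extension_section K G N H S E U i p s \<chi> \<psi> F"
proof -
  obtain s where s: "s \<in> linear_maps K G E" and ps: "\<And>x. x \<in> carrier G \<Longrightarrow> p (s x) = x"
    using linear_section_exists[OF G.field_axioms E.module_axioms G.module_axioms p_linear p_surj]
    by blast
  note D = linear_mapsD[OF s]
  have chi: "i_inv (\<lbrakk>s x, s y\<rbrakk>\<^bsub>E\<^esub> \<ominus>\<^bsub>E\<^esub> s (\<lbrakk>x, y\<rbrakk>\<^bsub>G\<^esub>)) \<in> carrier H"
      "i (i_inv (\<lbrakk>s x, s y\<rbrakk>\<^bsub>E\<^esub> \<ominus>\<^bsub>E\<^esub> s (\<lbrakk>x, y\<rbrakk>\<^bsub>G\<^esub>))) = \<lbrakk>s x, s y\<rbrakk>\<^bsub>E\<^esub> \<ominus>\<^bsub>E\<^esub> s (\<lbrakk>x, y\<rbrakk>\<^bsub>G\<^esub>)"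
    if "x \<in> carrier G" "y \<in> carrier G" for x y
    using that by (auto intro!: i_inv simp: D ip_linear_simps p_bracket ps G.M.abel_simps)
  have psi: "i_inv (\<lbrakk>s x, i h\<rbrakk>\<^bsub>E\<^esub>) \<in> carrier H" "i (i_inv (\<lbrakk>s x, i h\<rbrakk>\<^bsub>E\<^esub>)) = \<lbrakk>s x, i h\<rbrakk>\<^bsub>E\<^esub>"
    if "x \<in> carrier G" "h \<in> carrier H" for x h
    using that by (auto intro!: i_inv simp: D p_bracket ps p_i G.bracket_simps)
  have F: "i_inv (U (s x) \<ominus>\<^bsub>E\<^esub> s (N x)) \<in> carrier H"
      "i (i_inv (U (s x) \<ominus>\<^bsub>E\<^esub> s (N x))) = U (s x) \<ominus>\<^bsub>E\<^esub> s (N x)"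
    if "x \<in> carrier G" for x
    using that by (auto intro!: i_inv simp: D ip_linear_simps p_U ps G.M.abel_simps)
  have cancel: "b \<oplus>\<^bsub>E\<^esub> (a \<ominus>\<^bsub>E\<^esub> b) = a" if "a \<in> carrier E" "b \<in> carrier E" for a b
    using that by (simp add: E.M.minus_eq E.M.a_comm[of a] E.M.r_neg2)
  have "extension_section K G N H S E U i p s
      (\<lambda>x y. i_inv (\<lbrakk>s x, s y\<rbrakk>\<^bsub>E\<^esub> \<ominus>\<^bsub>E\<^esub> s (\<lbrakk>x, y\<rbrakk>\<^bsub>G\<^esub>))) (\<lambda>x h. i_inv (\<lbrakk>s x, i h\<rbrakk>\<^bsub>E\<^esub>))
      (\<lambda>x. i_inv (U (s x) \<ominus>\<^bsub>E\<^esub> s (N x)))"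
    by unfold_locales (simp_all add: s ps chi psi F D cancel)
  then show ?thesis by blast
qed

lemma (in nijenhuis_cocycle) cocycle_presented:
  fixes j :: "'g \<times> 'h \<Rightarrow> 'e"
  assumes "inj_on j (carrier G \<times> carrier H)"
  shows "\<exists>(E :: ('k, 'e) lie) U i p s. extension_section K G N H S E U i p s \<chi> \<psi> F"
proof -
  interpret cocycle_model K G N H S \<chi> \<psi> F j
    by unfold_locales fact
  show ?thesis using model_section by blast
qed

text \<open>An isomorphism transports a section of \<open>X\<close> to \<open>X'\<close> with the same cocycle \<open>c\<close>, so \<open>X'\<close> has
  sections for both \<open>c\<close> and \<open>c'\<close>, which are therefore equivalent. Conversely, an equivalence moves a
  section of \<open>X'\<close> for \<open>c'\<close> to one for \<open>c\<close>, and extensions with the same cocycle are isomorphic.\<close>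
lemma extension_iso_iff_cocycle_equiv:
  assumes "presents K G N H S X c" and "presents K G N H S X' c'"
  shows "(X, X') \<in> nab_extension_iso K G N H S \<longleftrightarrow> (c, c') \<in> nab_cocycle_equiv K G N H S"
proof -
  obtain E U i p where X: "X = (E, U, i, p)" by (cases X)
  obtain E' U' i' p' where X': "X' = (E', U', i', p')" by (cases X')
  obtain \<chi> \<psi> F where c: "c = (\<chi>, \<psi>, F)" by (cases c)
  obtain \<chi>' \<psi>' F' where c': "c' = (\<chi>', \<psi>', F')" by (cases c')
  obtain s s' where s: "extension_section K G N H S E U i p s \<chi> \<psi> F"
    and s': "extension_section K G N H S E' U' i' p' s' \<chi>' \<psi>' F'"
    using assms by (auto simp: presents_def X X' c c')
  interpret X: extension_section K G N H S E U i p s \<chi> \<psi> F by (fact s)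
  interpret Y: extension_section K G N H S E' U' i' p' s' \<chi>' \<psi>' F' by (fact s')
  show ?thesis
  proof
    assume "(X, X') \<in> nab_extension_iso K G N H S"
    then obtain \<Phi> where "\<Phi> \<in> nijenhuis_isos K E U E' U'"
      "\<forall>h\<in>carrier H. \<Phi> (i h) = i' h" "\<forall>e\<in>carrier E. p' (\<Phi> e) = p e"
      by (auto simp: nab_extension_iso_def X X')
    then have "extension_section K G N H S E' U' i' p' (\<lambda>x. \<Phi> (s x)) \<chi> \<psi> F"
      by (rule section_transport[OF s Y.nijenhuis_extension_axioms])
    then show "(c, c') \<in> nab_cocycle_equiv K G N H S"
      using equiv_of_two_sections[OF _ s'] by (simp add: c c')
  next
    assume "(c, c') \<in> nab_cocycle_equiv K G N H S"
    then have "\<exists>s. extension_section K G N H S E' U' i' p' s \<chi> \<psi> F"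
      unfolding nab_cocycle_equiv_def c c'
      using change_of_section[OF s'] by blast
    then obtain t where "extension_section K G N H S E' U' i' p' t \<chi> \<psi> F" ..
    then have "\<exists>\<Phi> \<in> nijenhuis_isos K E U E' U'.
      (\<forall>h\<in>carrier H. \<Phi> (i h) = i' h) \<and> (\<forall>e\<in>carrier E. p' (\<Phi> e) = p e)"
      by (rule iso_of_same_data[OF s])
    then show "(X, X') \<in> nab_extension_iso K G N H S"
      using X.nijenhuis_extension_axioms Y.nijenhuis_extension_axioms
      by (simp add: nab_extension_iso_def X X'
          nab_extensions_iff[OF X.G.nijenhuis_lie_algebra_axioms X.H.nijenhuis_lie_algebra_axioms])
  qed
qed

lemma nab_extension_iso_equiv:
  "equiv (nab_extensions K G N H S) (nab_extension_iso K G N H S)"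
proof (rule equivI)
  show "nab_extension_iso K G N H S \<subseteq> nab_extensions K G N H S \<times> nab_extensions K G N H S"
    by (auto simp: nab_extension_iso_def)
  show "refl_on (nab_extensions K G N H S) (nab_extension_iso K G N H S)"
  proof (rule refl_onI, clarify)
    fix E U i p assume "(E, U, i, p) \<in> nab_extensions K G N H S"
    moreover have "(\<lambda>e. e) \<in> nijenhuis_isos K E U E U"
      by (auto simp: nijenhuis_isos_def nijenhuis_homs_def lie_homs_def linear_maps_def bij_betw_def)
    ultimately show "((E, U, i, p), (E, U, i, p)) \<in> nab_extension_iso K G N H S"
      by (auto simp: nab_extension_iso_def)
  qed
  show "sym (nab_extension_iso K G N H S)"
  proof (rule symI, clarify)
    fix E U i p E' U' i' p'
    assume "((E, U, i, p), (E', U', i', p')) \<in> nab_extension_iso K G N H S"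
    then obtain \<Phi> where X: "(E, U, i, p) \<in> nab_extensions K G N H S"
        "(E', U', i', p') \<in> nab_extensions K G N H S"
      and \<Phi>: "\<Phi> \<in> nijenhuis_isos K E U E' U'"
        "\<forall>h\<in>carrier H. \<Phi> (i h) = i' h" "\<forall>e\<in>carrier E. p' (\<Phi> e) = p e"
      by (auto simp: nab_extension_iso_def)
    interpret E: nijenhuis_lie_algebra K E U
      using X by (simp add: nab_extensions_def)
    have lin: "\<Phi> \<in> linear_maps K E E'"
      and hom: "\<And>e f. \<lbrakk>e \<in> carrier E; f \<in> carrier E\<rbrakk> \<Longrightarrow> \<Phi> (\<lbrakk>e, f\<rbrakk>\<^bsub>E\<^esub>) = \<lbrakk>\<Phi> e, \<Phi> f\<rbrakk>\<^bsub>E'\<^esub>"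
      and op: "\<And>e. e \<in> carrier E \<Longrightarrow> \<Phi> (U e) = U' (\<Phi> e)"
      and bij: "bij_betw \<Phi> (carrier E) (carrier E')"
      using \<Phi>(1) by (auto simp: nijenhuis_isos_def nijenhuis_homs_def lie_homs_def)
    note D = linear_mapsD[OF lin]
    define \<Psi> where "\<Psi> = inv_into (carrier E) \<Phi>"
    have \<Psi>: "\<Psi> (\<Phi> e) = e" if "e \<in> carrier E" for e
      using bij that by (simp add: \<Psi>_def bij_betw_def)
    have ex: "\<exists>e\<in>carrier E. e' = \<Phi> e" if "e' \<in> carrier E'" for e'
      using bij that by (auto simp: bij_betw_def)
    have i: "i h \<in> carrier E" if "h \<in> carrier H" for h
      using X(1) that
      by (auto simp: nab_extensions_def nijenhuis_homs_def lie_homs_def linear_maps_def)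
    have "\<Psi> \<in> linear_maps K E' E"
      by (rule linear_mapsI) (auto dest!: ex simp: \<Psi> simp flip: D(2,3))
    then have "\<Psi> \<in> nijenhuis_isos K E' U' E U"
      using bij_betw_inv_into[OF bij]
      by (auto dest!: ex simp: nijenhuis_isos_def nijenhuis_homs_def lie_homs_def \<Psi> simp flip: \<Psi>_def hom op)
    moreover have "\<forall>h\<in>carrier H. \<Psi> (i' h) = i h"
      using \<Phi>(2) \<Psi> i by metis
    moreover have "\<forall>e\<in>carrier E'. p (\<Psi> e) = p' e"
      using \<Phi>(3) by (auto dest!: ex simp: \<Psi>)
    ultimately show "((E', U', i', p'), (E, U, i, p)) \<in> nab_extension_iso K G N H S"
      using X by (auto simp: nab_extension_iso_def)
  qed
  show "trans (nab_extension_iso K G N H S)"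
  proof (rule transI, clarify)
    fix E U i p E' U' i' p' E'' U'' i'' p''
    assume "((E, U, i, p), (E', U', i', p')) \<in> nab_extension_iso K G N H S"
      and "((E', U', i', p'), (E'', U'', i'', p'')) \<in> nab_extension_iso K G N H S"
    then obtain \<Phi> \<Psi> where X: "(E, U, i, p) \<in> nab_extensions K G N H S"
        "(E'', U'', i'', p'') \<in> nab_extensions K G N H S"
      and \<Phi>: "\<Phi> \<in> nijenhuis_isos K E U E' U'"
        "\<forall>h\<in>carrier H. \<Phi> (i h) = i' h" "\<forall>e\<in>carrier E. p' (\<Phi> e) = p e"
      and \<Psi>: "\<Psi> \<in> nijenhuis_isos K E' U' E'' U''"
        "\<forall>h\<in>carrier H. \<Psi> (i' h) = i'' h" "\<forall>e\<in>carrier E'. p'' (\<Psi> e) = p' e"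
      by (auto simp: nab_extension_iso_def)
    have "\<Phi> e \<in> carrier E'" if "e \<in> carrier E" for e
      using \<Phi>(1) that by (auto simp: nijenhuis_isos_def bij_betw_def)
    moreover from this have "(\<lambda>e. \<Psi> (\<Phi> e)) \<in> nijenhuis_isos K E U E'' U''"
      using \<Phi>(1) \<Psi>(1) bij_betw_trans[of \<Phi> "carrier E" "carrier E'" \<Psi> "carrier E''"]
      by (auto simp: nijenhuis_isos_def nijenhuis_homs_def lie_homs_def linear_maps_def comp_def)
    ultimately show "((E, U, i, p), (E'', U'', i'', p'')) \<in> nab_extension_iso K G N H S"
      using X \<Phi>(2,3) \<Psi>(2,3) unfolding nab_extension_iso_def
      by (auto intro!: bexI[of _ "\<lambda>e. \<Psi> (\<Phi> e)"])
  qed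
qed

theorem theorem3p4:
  fixes K :: "('k, 'c) ring_scheme"
    and G :: "('k, 'g, 'm) lie_scheme" and N :: "'g \<Rightarrow> 'g"
    and H :: "('k, 'h, 'n) lie_scheme" and S :: "'h \<Rightarrow> 'h"
  assumes "nijenhuis_lie_algebra K G N"
    and "nijenhuis_lie_algebra K H S"
    and "\<exists>j :: 'g \<times> 'h \<Rightarrow> 'e. inj_on j (carrier G \<times> carrier H)"
  shows "\<exists>f :: ('k, 'e, 'g, 'h) extension set \<Rightarrow> ('g, 'h) cochain set.
    bij_betw f (Ext_nab K G N H S) (H2_nab K G N H S)"
  unfolding Ext_nab_def H2_nab_def
proof (rule quotient_bijection[where R = "presents K G N H S"])
  obtain j :: "'g \<times> 'h \<Rightarrow> 'e" where j: "inj_on j (carrier G \<times> carrier H)"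
    using assms(3) by blast
  fix X :: "('k, 'e, 'g, 'h) extension" and c :: "('g, 'h) cochain"
  obtain E U i p where X: "X = (E, U, i, p)" by (cases X)
  obtain \<chi> \<psi> F where c: "c = (\<chi>, \<psi>, F)" by (cases c)
  show "X \<in> nab_extensions K G N H S \<and> c \<in> nab_cocycles K G N H S" if "presents K G N H S X c"
    using that extension_section.axioms(1) extension_section.cocycle
    by (fastforce simp: presents_def X c nab_extensions_iff[OF assms(1,2)])
  show "\<exists>c. presents K G N H S X c" if "X \<in> nab_extensions K G N H S"
    using that nijenhuis_extension.section_data_exists
    by (fastforce simp: presents_def X nab_extensions_iff[OF assms(1,2)])
  show "\<exists>X :: ('k, 'e, 'g, 'h) extension. presents K G N H S X c"
    if "c \<in> nab_cocycles K G N H S"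
  proof -
    interpret nijenhuis_cocycle K G N H S \<chi> \<psi> F
      using that assms by (simp add: nijenhuis_cocycle_def nijenhuis_cocycle_axioms_def c)
    show ?thesis using cocycle_presented[OF j] by (fastforce simp: presents_def c)
  qed
next
  show "equiv (nab_extensions K G N H S) (nab_extension_iso K G N H S)"
    by (rule nab_extension_iso_equiv)
  show "nab_cocycle_equiv K G N H S \<subseteq> nab_cocycles K G N H S \<times> nab_cocycles K G N H S"
    by (auto simp: nab_cocycle_equiv_def)
qed (rule extension_iso_iff_cocycle_equiv)

end
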